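(* Let $V$ be a separable Banach space and let $X\colon V^*\to L^2_P(\Omega;\mathbb{R})$ be an infinitely divisible cylindrical random variable in $V$ with weak second moments, with $E[Xv^*]=0$ for all $v^*\in V^*$, and with $V$-valued covariance operator $Q\colon V^*\to V$, $\langle Qv^*,w^*\rangle=E[(Xv^* )(Xw^* )]$. Let $H$ be the separable Hilbert space and $j\in\mathcal{L}(H,V)$ with $Q=jj^*$ and $j^*(V^* )$ dense in $H$; let $(e_k)_{k\in\mathbb{N}}$ be an orthonormal basis of $H$ and $v_k^*\in V^*$ with $j^*v_k^*=e_k$ for all $k$. Let $\theta_X$ be the cylindrical distribution of the cylindrical random variable $$\Theta_X\colon H\to L^2_P(\Omega;\mathbb{R}),\qquad\Theta_Xh=\sum_{k=1}^\infty\langle e_k,h\rangle\,Xv_k^*.$$ Then: (a) $E[|\Theta_Xh|^2]=\|h\|^2$ for all $h\in H$; (b) the cylindrical distribution of $X$ equals $\theta_X\circ j^{-1}$; (c) $\theta_X$ is of cotype $2$; (d) $\theta_X$ is infinitely divisible.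
   Context: All spaces are real; the sum defining $\Theta_Xh$ converges in $L^2_P(\Omega;\mathbb{R})$. For a separable Banach space $V$ with dual $V^*$, cylindrical sets are the sets $\{v\in V:(\langle v,v_1^*\rangle,\dots,\langle v,v_n^*\rangle)\in B\}$ with $n\in\mathbb{N}$, $v_i^*\in V^*$, $B\in\mathcal{B}(\mathbb{R}^n)$; they form the algebra $\mathcal{Z}(V)$. A cylindrical probability measure $\eta$ on $\mathcal{Z}(V)$ is a set function with $\eta(V)=1$ whose restriction to the $\sigma$-algebra generated by any finite set of functionals in $V^*$ is a measure; characteristic functions $v^*\mapsto\int_Ve^{i\langle v,v^*\rangle}\eta(dv)$ are assumed continuous. $\eta$ is infinitely divisible if for each $k\in\mathbb{N}$ there is a cylindrical probability measure $\eta_k$ with $\eta=\eta_k^{*k}$ ($k$-fold convolution); by a known theorem this is equivalent to: for all $m\in\mathbb{N}$ and $v_1^*,\dots,v_m^*\in V^*$ the image of $\eta$ under $v\mapsto(\langle v,v_1^*\rangle,\dots,\langle v,v_m^*\rangle)$ is infinitely divisible on $\mathcal{B}(\mathbb{R}^m)$. $\eta$ is of cotype $p$ if $\int_V|\langle v,v^*\rangle|^p\,\eta(dv)<\infty$ for all $v^*\in V^*$ and for each sequence $(v_n^* )\subseteq V^*$, $\int_V|\langle v,v_n^*\rangle|^p\,\eta(dv)\to0$ implies $\|v_n^*\|\to0$. A cylindrical random variable $Z$ in $V$ is a continuous linear map $Z\colon V^*\to L^0_P(\Omega;\mathbb{R})$ (convergence in probability); its cylindrical distribution assigns to the cylindrical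 set above the value $P((Zv_1^*,\dots,Zv_n^* )\in B)$. $Z$ is infinitely divisible if its cylindrical distribution is, and has weak second moments if $E[|Zv^*|^2]<\infty$ for all $v^*\in V^*$. The same definitions apply to a separable Hilbert space $H$ (identified with its dual). $\theta_X\circ j^{-1}$ is the cylindrical measure $C\mapsto\theta_X(j^{-1}(C))$ on $\mathcal{Z}(V)$. *)

theory Defs
  imports "HOL-Probability.Probability"
begin

text \<open>
  The dual of a Banach space \<open>'v\<close> is the type \<open>'v \<Rightarrow>\<^sub>L real\<close>. Elements of \<open>L\<^sup>0\<close> and \<open>L\<^sup>2\<close> are
  represented by measurable functions, so identities between them hold almost everywhere.
  Measures take values in \<^typ>\<open>ennreal\<close>, and \<open>\<real>\<^sup>n\<close> with its Borel sigma-algebra is the product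
  \<open>\<Pi>\<^sub>M i\<in>{..<n}. borel\<close>.
\<close>

subsection \<open>Cylindrical sets and cylindrical probability measures\<close>

definition cyl_set ::
  "nat \<Rightarrow> (nat \<Rightarrow> ('v::real_normed_vector \<Rightarrow>\<^sub>L real)) \<Rightarrow> (nat \<Rightarrow> real) set \<Rightarrow> 'v set" where
  "cyl_set n f B = {v. (\<lambda>i\<in>{..<n}. f i v) \<in> B}"

definition cylindrical_sets :: "'v::real_normed_vector set set" where
  "cylindrical_sets = {cyl_set n f B | n f B. B \<in> sets (\<Pi>\<^sub>M i\<in>{..<n}. (borel :: real measure))}"

definition cyl_generator :: "('v::real_normed_vector \<Rightarrow>\<^sub>L real) set \<Rightarrow> 'v set set" where
  "cyl_generator \<Gamma> = {blinfun_apply f -` B | f B. f \<in> \<Gamma> \<and> B \<in> sets (borel :: real measure)}"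

text \<open>
  The restriction of a set function to the sigma-algebra generated by the functionals in \<open>\<Gamma>\<close>,
  as a measure. It is meaningful only if that restriction is countably additive.
\<close>

definition cyl_restrict ::
  "('v::real_normed_vector set \<Rightarrow> ennreal) \<Rightarrow> ('v \<Rightarrow>\<^sub>L real) set \<Rightarrow> 'v measure" where
  "cyl_restrict \<eta> \<Gamma> = measure_of UNIV (cyl_generator \<Gamma>) \<eta>"

definition cyl_char ::
  "('v::real_normed_vector set \<Rightarrow> ennreal) \<Rightarrow> ('v \<Rightarrow>\<^sub>L real) \<Rightarrow> complex" where
  "cyl_char \<eta> f = (\<integral>v. exp (\<i> * complex_of_real (f v)) \<partial>(cyl_restrict \<eta> {f}))"

text \<open>Only the values of \<open>\<eta>\<close> on \<open>cylindrical_sets\<close> are relevant.\<close>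

definition cylindrical_prob :: "('v::real_normed_vector set \<Rightarrow> ennreal) \<Rightarrow> bool" where
  "cylindrical_prob \<eta> \<longleftrightarrow>
     \<eta> UNIV = 1 \<and>
     (\<forall>\<Gamma>. finite \<Gamma> \<longrightarrow> measure_space UNIV (sigma_sets UNIV (cyl_generator \<Gamma>)) \<eta>) \<and>
     continuous_on UNIV (cyl_char \<eta>)"

text \<open>
  \<open>\<eta> = \<rho>\<^sup>*\<^sup>k\<close> on the cylindrical sets: on the sigma-algebra generated by any finite set of
  functionals, \<open>\<eta>\<close> is the image of the \<open>k\<close>-fold product of \<open>\<rho>\<close> under
  \<open>(x\<^sub>0, \<dots>, x\<^sub>k\<^sub>-\<^sub>1) \<mapsto> x\<^sub>0 + \<dots> + x\<^sub>k\<^sub>-\<^sub>1\<close>.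
\<close>

definition is_convolution_power ::
  "('v::real_normed_vector set \<Rightarrow> ennreal) \<Rightarrow> nat \<Rightarrow> ('v set \<Rightarrow> ennreal) \<Rightarrow> bool" where
  "is_convolution_power \<rho> k \<eta> \<longleftrightarrow>
     (\<forall>\<Gamma>. finite \<Gamma> \<longrightarrow>
        cyl_restrict \<eta> \<Gamma> =
        distr (\<Pi>\<^sub>M i\<in>{..<k}. cyl_restrict \<rho> \<Gamma>) (cyl_restrict \<eta> \<Gamma>) (\<lambda>x. \<Sum>i<k. x i))"

definition cyl_infinitely_divisible :: "('v::real_normed_vector set \<Rightarrow> ennreal) \<Rightarrow> bool" where
  "cyl_infinitely_divisible \<eta> \<longleftrightarrow>
     cylindrical_prob \<eta> \<and>
     (\<forall>k\<ge>1. \<exists>\<rho>. cylindrical_prob \<rho> \<and> is_convolution_power \<rho> k \<eta>)"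

definition cyl_moment ::
  "('v::real_normed_vector set \<Rightarrow> ennreal) \<Rightarrow> real \<Rightarrow> ('v \<Rightarrow>\<^sub>L real) \<Rightarrow> ennreal" where
  "cyl_moment \<eta> p f = (\<integral>\<^sup>+ v. ennreal (\<bar>f v\<bar> powr p) \<partial>(cyl_restrict \<eta> {f}))"

definition cyl_cotype :: "real \<Rightarrow> ('v::real_normed_vector set \<Rightarrow> ennreal) \<Rightarrow> bool" where
  "cyl_cotype p \<eta> \<longleftrightarrow>
     cylindrical_prob \<eta> \<and>
     (\<forall>f. cyl_moment \<eta> p f < \<infinity>) \<and>
     (\<forall>f :: nat \<Rightarrow> ('v \<Rightarrow>\<^sub>L real).
        (\<lambda>n. cyl_moment \<eta> p (f n)) \<longlonglongrightarrow> 0 \<longrightarrow> (\<lambda>n. norm (f n)) \<longlonglongrightarrow> 0)"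

subsection \<open>Cylindrical random variables\<close>

definition cylindrical_rv ::
  "'w measure \<Rightarrow> (('v::real_normed_vector \<Rightarrow>\<^sub>L real) \<Rightarrow> 'w \<Rightarrow> real) \<Rightarrow> bool" where
  "cylindrical_rv M Z \<longleftrightarrow>
     (\<forall>f. Z f \<in> borel_measurable M) \<and>
     (\<forall>a b f g. AE \<omega> in M. Z (a *\<^sub>R f + b *\<^sub>R g) \<omega> = a * Z f \<omega> + b * Z g \<omega>) \<and>
     (\<forall>fs f. fs \<longlonglongrightarrow> f \<longrightarrow>
        (\<forall>\<epsilon>>0. (\<lambda>n. measure M {\<omega> \<in> space M. \<bar>Z (fs n) \<omega> - Z f \<omega>\<bar> > \<epsilon>}) \<longlonglongrightarrow> 0))"

text \<open>
  By linearity of \<open>Z\<close>, the value does not depend on the representation of the cylindrical set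
  \<open>C\<close>; hence the definite description. Outside \<open>cylindrical_sets\<close> the value is unspecified.
\<close>

definition cyl_distr ::
  "'w measure \<Rightarrow> (('v::real_normed_vector \<Rightarrow>\<^sub>L real) \<Rightarrow> 'w \<Rightarrow> real) \<Rightarrow> 'v set \<Rightarrow> ennreal" where
  "cyl_distr M Z C =
     (THE p. \<exists>n f B. B \<in> sets (\<Pi>\<^sub>M i\<in>{..<n}. (borel :: real measure)) \<and> C = cyl_set n f B \<and>
        p = emeasure M {\<omega> \<in> space M. (\<lambda>i\<in>{..<n}. Z (f i) \<omega>) \<in> B})"

definition square_integrable :: "'w measure \<Rightarrow> ('w \<Rightarrow> real) \<Rightarrow> bool" where
  "square_integrable M Y \<longleftrightarrow> Y \<in> borel_measurable M \<and> integrable M (\<lambda>\<omega>. (Y \<omega>)\<^sup>2)"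

definition covariance_operator ::
  "'w measure \<Rightarrow> (('v::real_normed_vector \<Rightarrow>\<^sub>L real) \<Rightarrow> 'w \<Rightarrow> real) \<Rightarrow> (('v \<Rightarrow>\<^sub>L real) \<Rightarrow> 'v) \<Rightarrow> bool" where
  "covariance_operator M X Q \<longleftrightarrow> (\<forall>f g. blinfun_apply g (Q f) = (\<integral>\<omega>. X f \<omega> * X g \<omega> \<partial>M))"

subsection \<open>Hilbert spaces\<close>

text \<open>The identification of the dual of a Hilbert space with the space itself.\<close>

definition riesz :: "('h::{real_inner,banach} \<Rightarrow>\<^sub>L real) \<Rightarrow> 'h" where
  "riesz f = (THE h. \<forall>x. f x = h \<bullet> x)"

definition hilbert_adjoint ::
  "('h::{real_inner,banach} \<Rightarrow>\<^sub>L 'v::real_normed_vector) \<Rightarrow> ('v \<Rightarrow>\<^sub>L real) \<Rightarrow> 'h" where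
  "hilbert_adjoint j f = riesz (f o\<^sub>L j)"

definition orthonormal_basis :: "(nat \<Rightarrow> 'h::real_inner) \<Rightarrow> bool" where
  "orthonormal_basis e \<longleftrightarrow>
     (\<forall>k l. e k \<bullet> e l = (if k = l then 1 else 0)) \<and> closure (span (range e)) = UNIV"

subsection \<open>The cylindrical random variable \<open>\<Theta>\<^sub>X\<close>\<close>

definition L2_sums :: "'w measure \<Rightarrow> (nat \<Rightarrow> 'w \<Rightarrow> real) \<Rightarrow> ('w \<Rightarrow> real) \<Rightarrow> bool" where
  "L2_sums M Y S \<longleftrightarrow>
     (\<forall>k. square_integrable M (Y k)) \<and> square_integrable M S \<and>
     (\<lambda>n. \<integral>\<omega>. ((\<Sum>k<n. Y k \<omega>) - S \<omega>)\<^sup>2 \<partial>M) \<longlonglongrightarrow> 0"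

text \<open>The \<open>L\<^sup>2\<close> limit is unique up to null sets; \<open>SOME\<close> selects one representative.\<close>

definition Theta ::
  "'w measure \<Rightarrow> (('v::real_normed_vector \<Rightarrow>\<^sub>L real) \<Rightarrow> 'w \<Rightarrow> real) \<Rightarrow>
   (nat \<Rightarrow> 'h::real_inner) \<Rightarrow> (nat \<Rightarrow> ('v \<Rightarrow>\<^sub>L real)) \<Rightarrow> 'h \<Rightarrow> 'w \<Rightarrow> real" where
  "Theta M X e vs h = (SOME S. L2_sums M (\<lambda>k \<omega>. (e k \<bullet> h) * X (vs k) \<omega>) S)"

definition theta_distr ::
  "'w measure \<Rightarrow> (('v::real_normed_vector \<Rightarrow>\<^sub>L real) \<Rightarrow> 'w \<Rightarrow> real) \<Rightarrow>
   (nat \<Rightarrow> 'h::{real_inner,banach}) \<Rightarrow> (nat \<Rightarrow> ('v \<Rightarrow>\<^sub>L real)) \<Rightarrow> 'h set \<Rightarrow> ennreal" where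
  "theta_distr M X e vs = cyl_distr M (\<lambda>f. Theta M X e vs (riesz f))"

end

theory Submission
  imports Defs
begin

text \<open>
  The second moments of \<open>X\<close> are \<open>E[(X f)\<^sup>2] = \<langle>Q f, f\<rangle> = \<parallel>j\<^sup>* f\<parallel>\<^sup>2\<close>, so \<open>j\<^sup>* f \<mapsto> X f\<close> is a linear
  isometry from the range of \<open>j\<^sup>*\<close> into \<open>L\<^sup>2\<close>, and the variables \<open>X v\<^sub>l\<^sup>*\<close> are orthonormal.  The map
  \<open>\<Theta>\<^sub>X\<close> is the isometric extension of it to \<open>H\<close>.  Claim (a) is this isometry in the limit.  For (b),
  \<open>\<Theta>\<^sub>X (j\<^sup>* f) = X f\<close> almost surely, by expanding \<open>j\<^sup>* f\<close> in the basis, and the preimage under \<open>j\<close> of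
  the cylinder set over \<open>f\<^sub>1, \<dots>, f\<^sub>n\<close> is the cylinder set over \<open>j\<^sup>* f\<^sub>1, \<dots>, j\<^sup>* f\<^sub>n\<close> with the same base.
  For (c), the second moment of \<open>\<theta>\<^sub>X\<close> at \<open>h\<close> is \<open>\<parallel>h\<parallel>\<^sup>2\<close>.

  That a cylindrical distribution is well defined and is a measure on each sigma-algebra
  generated by a finite set \<open>\<Gamma>\<close> of functionals rests on \<open>linear_process_realization\<close>: on \<open>\<Gamma>\<close>, a
  linear process \<open>Z\<close> has the form \<open>Z f = f V\<close> with a random vector \<open>V\<close> of finite-dimensional range, so
  that there the cylindrical distribution of \<open>Z\<close> is the image measure of \<open>V\<close>.

  For (d), let \<open>\<rho>\<close> be a \<open>k\<close>-th convolution root of the distribution of \<open>X\<close>.  The distribution of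
  \<open>\<Theta>\<^sub>X\<close> depends only on the law of the sequence \<open>(X v\<^sub>l\<^sup>*)\<^sub>l\<close>, and this allows the root of \<open>\<theta>\<^sub>X\<close> to be
  written down directly.  By Kolmogorov's theorem there is a law \<open>\<nu>\<close> on the space of real sequences
  whose finite-dimensional marginals are the images of \<open>\<rho>\<close> under the \<open>v\<^sub>l\<^sup>*\<close>
  (\<open>kolmogorov_sequence_law\<close>).  The sum of \<open>k\<close> independent sequences with law \<open>\<nu>\<close> has the law of
  \<open>(X v\<^sub>l\<^sup>*)\<^sub>l\<close> (\<open>distr_sequences_convolution_power\<close>).  Since \<open>X\<close> is centred, so is each summand, and
  the second moments of a summand are at most those of the sum (\<open>iid_sum_square_bound\<close>).  Hence the
  series that defines \<open>\<Theta>\<^sub>X\<close> also converges in \<open>L\<^sup>2\<close> when the coordinates of \<open>\<nu>\<close> replace the variables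
  \<open>X v\<^sub>l\<^sup>*\<close>, and its limit is a cylindrical random variable on \<open>H\<close>.  Forming \<open>L\<^sup>2\<close> limits commutes with
  finite sums and with changes of the probability space, so the sum of \<open>k\<close> independent copies of
  this limit is distributed as \<open>\<Theta>\<^sub>X\<close> (\<open>is_convolution_power_L2_series\<close>).
\<close>

section \<open>Linear processes and their cylindrical distributions\<close>

text \<open>
  The algebraic part of a cylindrical random variable.  Linearity makes the cylindrical distribution
  well defined; continuity of its characteristic function is obtained from bounds on second moments.
\<close>

definition linear_process ::
  "'w measure \<Rightarrow> (('v::real_normed_vector \<Rightarrow>\<^sub>L real) \<Rightarrow> 'w \<Rightarrow> real) \<Rightarrow> bool" where
  "linear_process M Z \<longleftrightarrow>
     (\<forall>f. Z f \<in> borel_measurable M) \<and>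
     (\<forall>a b f g. AE \<omega> in M. Z (a *\<^sub>R f + b *\<^sub>R g) \<omega> = a * Z f \<omega> + b * Z g \<omega>)"

lemma linear_process_measurable [measurable_dest]:
  "linear_process M Z \<Longrightarrow> Z f \<in> borel_measurable M"
  by (simp add: linear_process_def)

lemma linear_process_combination:
  assumes "linear_process M Z"
  shows "AE \<omega> in M. Z (a *\<^sub>R f + b *\<^sub>R g) \<omega> = a * Z f \<omega> + b * Z g \<omega>"
  using assms by (simp add: linear_process_def)

lemma linear_process_sum:
  assumes Z: "linear_process M Z"
  shows "AE \<omega> in M. Z (\<Sum>i<n::nat. c i *\<^sub>R g i) \<omega> = (\<Sum>i<n. c i * Z (g i) \<omega>)"
proof (induction n)
  case 0
  show ?case
    using linear_process_combination[OF Z, of 0 0 0 0] by simp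
next
  case (Suc n)
  from linear_process_combination[OF Z, of 1 "\<Sum>i<n. c i *\<^sub>R g i" "c n" "g n"] Suc
  show ?case by eventually_elim simp
qed

text \<open>
  Gram-Schmidt for functionals: if the part \<open>f'\<close> of a new functional \<open>f\<close> that the \<open>g\<^sub>i\<close> do not
  represent is nonzero, a vector on which \<open>f'\<close> does not vanish is corrected by the \<open>u\<^sub>i\<close> until the
  old \<open>g\<^sub>i\<close> vanish on it.
\<close>

lemma finite_biorthogonal_system:
  fixes \<Gamma> :: "('v::real_normed_vector \<Rightarrow>\<^sub>L real) set"
  assumes "finite \<Gamma>"
  shows "\<exists>n (g :: nat \<Rightarrow> 'v \<Rightarrow>\<^sub>L real) u.
    (\<forall>i<n. \<forall>l<n. blinfun_apply (g i) (u l) = (if i = l then 1 else 0)) \<and>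
    (\<forall>f\<in>\<Gamma>. f = (\<Sum>i<n. blinfun_apply f (u i) *\<^sub>R g i))"
  using assms
proof (induction \<Gamma> rule: finite_induct)
  case empty
  show ?case by (rule exI[of _ 0]) auto
next
  case (insert f \<Gamma>)
  then obtain n and g :: "nat \<Rightarrow> 'v \<Rightarrow>\<^sub>L real" and u where
    bi: "\<And>i l. i < n \<Longrightarrow> l < n \<Longrightarrow> g i (u l) = (if i = l then 1 else 0)" and
    rep: "\<And>h. h \<in> \<Gamma> \<Longrightarrow> h = (\<Sum>i<n. h (u i) *\<^sub>R g i)" by blast
  define f' where "f' = f - (\<Sum>i<n. f (u i) *\<^sub>R g i)"
  show ?case
  proof (cases "f' = 0")
    case True
    then have "f = (\<Sum>i<n. f (u i) *\<^sub>R g i)" by (simp add: f'_def)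
    with bi rep show ?thesis by blast
  next
    case False
    then obtain w where w: "f' w \<noteq> 0"
      by (metis blinfun_eqI zero_blinfun.rep_eq)
    define u' where "u' = (1 / f' w) *\<^sub>R (w - (\<Sum>i<n. g i w *\<^sub>R u i))"
    have f'_u: "f' (u l) = 0" if "l < n" for l
      using that by (simp add: f'_def blinfun.diff_left blinfun.sum_left blinfun.scaleR_left bi
          if_distrib sum.If_cases cong: if_cong)
    have f'_u': "f' u' = 1"
      using w by (simp add: u'_def blinfun.scaleR_right blinfun.diff_right blinfun.sum_right f'_u)
    have g_u': "g i u' = 0" if "i < n" for i
      using that by (simp add: u'_def blinfun.scaleR_right blinfun.diff_right blinfun.sum_right bi
          if_distrib sum.If_cases cong: if_cong)
    define G where "G = g(n := f')"
    define U where "U = u(n := u')"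
    have 1: "G i (U l) = (if i = l then 1 else 0)" if "i < Suc n" "l < Suc n" for i l
      using that bi f'_u f'_u' g_u' by (auto simp: G_def U_def less_Suc_eq)
    have sum_Suc: "(\<Sum>i<Suc n. h (U i) *\<^sub>R G i) = (\<Sum>i<n. h (u i) *\<^sub>R g i) + h u' *\<^sub>R f'"
      for h :: "'v \<Rightarrow>\<^sub>L real" by (simp add: G_def U_def)
    have "f u' = (f' + (\<Sum>i<n. f (u i) *\<^sub>R g i)) u'" by (simp add: f'_def)
    also have "\<dots> = 1"
      by (simp add: blinfun.add_left blinfun.sum_left blinfun.scaleR_left f'_u' g_u')
    finally have 2: "f = (\<Sum>i<Suc n. f (U i) *\<^sub>R G i)"
      unfolding sum_Suc by (simp add: f'_def)
    have 3: "h = (\<Sum>i<Suc n. h (U i) *\<^sub>R G i)" if "h \<in> \<Gamma>" for h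
    proof -
      have "h u' = (\<Sum>i<n. h (u i) *\<^sub>R g i) u'" using rep[OF that] by simp
      also have "\<dots> = 0" by (simp add: blinfun.sum_left blinfun.scaleR_left g_u')
      finally show ?thesis unfolding sum_Suc using rep[OF that] by simp
    qed
    show ?thesis
      by (rule exI[of _ "Suc n"], rule exI[of _ G], rule exI[of _ U]) (use 1 2 3 in auto)
  qed
qed

lemma blinfun_borel_measurable [measurable]:
  "blinfun_apply f \<in> borel_measurable borel"
  by (intro borel_measurable_continuous_onI linear_continuous_on blinfun.bounded_linear_right)

text \<open>
  With a biorthogonal system \<open>(g\<^sub>i, u\<^sub>i)\<close> for \<open>\<Gamma>\<close>, the vector \<open>V = \<Sum>\<^sub>i (Z g\<^sub>i) u\<^sub>i\<close> does it, because
  \<open>f = \<Sum>\<^sub>i (f u\<^sub>i) g\<^sub>i\<close> for \<open>f \<in> \<Gamma>\<close>.  In general no random vector realizes \<open>Z\<close> on all functionals at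
  once, but a cylinder set involves finitely many.
\<close>

lemma linear_process_realization:
  fixes Z :: "('v::{real_normed_vector,second_countable_topology} \<Rightarrow>\<^sub>L real) \<Rightarrow> 'w \<Rightarrow> real"
  assumes Z: "linear_process M Z" and "finite \<Gamma>"
  obtains V where "V \<in> borel_measurable M" "AE \<omega> in M. \<forall>f\<in>\<Gamma>. Z f \<omega> = f (V \<omega>)"
proof -
  from finite_biorthogonal_system[OF \<open>finite \<Gamma>\<close>] obtain n and g :: "nat \<Rightarrow> 'v \<Rightarrow>\<^sub>L real" and u where
    rep: "\<And>f. f \<in> \<Gamma> \<Longrightarrow> f = (\<Sum>i<n. f (u i) *\<^sub>R g i)" by blast
  note [measurable] = linear_process_measurable[OF Z]
  define V where "V \<omega> = (\<Sum>i<n. Z (g i) \<omega> *\<^sub>R u i)" for \<omega>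
  have "V \<in> borel_measurable M" unfolding V_def by measurable
  moreover have "AE \<omega> in M. Z f \<omega> = f (V \<omega>)" if "f \<in> \<Gamma>" for f
    using linear_process_sum[OF Z, where n = n and c = "\<lambda>i. f (u i)" and g = g]
    by eventually_elim
      (simp add: rep[OF that, symmetric] V_def blinfun.sum_right blinfun.scaleR_right mult.commute)
  then have "AE \<omega> in M. \<forall>f\<in>\<Gamma>. Z f \<omega> = f (V \<omega>)"
    using \<open>finite \<Gamma>\<close> by (simp add: AE_ball_countable countable_finite)
  ultimately show thesis by (rule that)
qed

abbreviation cyl_sigma :: "('v::real_normed_vector \<Rightarrow>\<^sub>L real) set \<Rightarrow> 'v measure" where
  "cyl_sigma \<Gamma> \<equiv> sigma UNIV (cyl_generator \<Gamma>)"

lemma space_cyl_restrict [simp]: "space (cyl_restrict \<eta> \<Gamma>) = UNIV"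
  by (simp add: cyl_restrict_def space_measure_of_conv)

lemma sets_cyl_restrict: "sets (cyl_restrict \<eta> \<Gamma>) = sigma_sets UNIV (cyl_generator \<Gamma>)"
  by (simp add: cyl_restrict_def)

lemma sets_cyl_restrict_cong [measurable_cong]: "sets (cyl_restrict \<eta> \<Gamma>) = sets (cyl_sigma \<Gamma>)"
  by (simp add: sets_cyl_restrict)

lemma measurable_functional_cyl_sigma:
  assumes "f \<in> \<Gamma>"
  shows "blinfun_apply f \<in> borel_measurable (cyl_sigma \<Gamma>)"
  by (rule measurableI) (use assms in \<open>auto simp: cyl_generator_def\<close>)

lemma measurable_into_cyl_sigma:
  fixes \<Gamma> :: "('v::real_normed_vector \<Rightarrow>\<^sub>L real) set"
  assumes "\<And>f. f \<in> \<Gamma> \<Longrightarrow> (\<lambda>x. f (V x)) \<in> borel_measurable M"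
  shows "V \<in> measurable M (cyl_sigma \<Gamma>)"
proof (rule measurable_measure_of)
  fix y assume "y \<in> cyl_generator \<Gamma>"
  then obtain f B where "f \<in> \<Gamma>" "B \<in> sets borel" "y = blinfun_apply f -` B"
    by (auto simp: cyl_generator_def)
  with assms[OF \<open>f \<in> \<Gamma>\<close>] show "V -` y \<inter> space M \<in> sets M"
    by (auto simp: measurable_def vimage_def)
qed auto

lemma cyl_set_borel:
  assumes "B \<in> sets (\<Pi>\<^sub>M i\<in>{..<n}. (borel :: real measure))"
  shows "cyl_set n f B \<in> sets borel"
proof -
  note [measurable] = assms
  show ?thesis unfolding cyl_set_def by measurable
qed

text \<open>
  The cylinder sets over a fixed enumeration of \<open>\<Gamma>\<close> are preimages of a sigma-algebra, so they are
  closed under the sigma-algebra operations.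
\<close>

lemma sigma_sets_cyl_generator:
  assumes "finite \<Gamma>" "A \<in> sigma_sets UNIV (cyl_generator \<Gamma>)"
  obtains n f B where "f ` {..<n} = \<Gamma>" "B \<in> sets (\<Pi>\<^sub>M i\<in>{..<n}. (borel :: real measure))"
    "A = cyl_set n f B"
proof -
  from \<open>finite \<Gamma>\<close> obtain n :: nat and f where f: "\<Gamma> = f ` {..<n}"
    by (auto simp: finite_conv_nat_seg_image lessThan_def)
  let ?P = "\<Pi>\<^sub>M i\<in>{..<n}. (borel :: real measure)"
  let ?F = "\<lambda>v. \<lambda>i\<in>{..<n}. f i v"
  let ?V = "vimage_algebra UNIV ?F ?P"
  have V: "sets ?V = {?F -` B \<inter> UNIV | B. B \<in> sets ?P}"
    by (rule sets_vimage_algebra2) (auto simp: space_PiM)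
  have "cyl_generator \<Gamma> \<subseteq> sets ?V"
  proof
    fix y assume "y \<in> cyl_generator \<Gamma>"
    then obtain i B where i: "i < n" and B: "B \<in> sets borel" and y: "y = blinfun_apply (f i) -` B"
      by (auto simp: cyl_generator_def f)
    have "{x \<in> space ?P. x i \<in> B} \<in> sets ?P" using i B
      by (intro measurable_sets_Collect[of "\<lambda>x. x i" ?P borel "\<lambda>r. r \<in> B"] measurable_component_singleton) auto
    moreover have "y = ?F -` {x \<in> space ?P. x i \<in> B} \<inter> UNIV"
      using i by (auto simp: y space_PiM)
    ultimately show "y \<in> sets ?V" unfolding V by blast
  qed
  then have "sigma_sets UNIV (cyl_generator \<Gamma>) \<subseteq> sets ?V"
    using sets.sigma_sets_subset[of "cyl_generator \<Gamma>" ?V] by simp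
  with assms(2) obtain B where "B \<in> sets ?P" "A = ?F -` B \<inter> UNIV" unfolding V by blast
  then show thesis using f by (intro that[of f n B]) (auto simp: cyl_set_def)
qed

lemma emeasure_realized_cyl_set:
  fixes Z :: "('v::{real_normed_vector,second_countable_topology} \<Rightarrow>\<^sub>L real) \<Rightarrow> 'w \<Rightarrow> real"
  assumes Z: "linear_process M Z" and V [measurable]: "V \<in> borel_measurable M"
    and ae: "AE \<omega> in M. \<forall>f\<in>\<Gamma>. Z f \<omega> = f (V \<omega>)" and f: "f ` {..<n} \<subseteq> \<Gamma>"
    and B [measurable]: "B \<in> sets (\<Pi>\<^sub>M i\<in>{..<n}. (borel :: real measure))"
  shows "emeasure M {\<omega> \<in> space M. (\<lambda>i\<in>{..<n}. Z (f i) \<omega>) \<in> B} =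
    emeasure M {\<omega> \<in> space M. V \<omega> \<in> cyl_set n f B}"
proof (rule emeasure_eq_AE)
  note [measurable] = linear_process_measurable[OF Z] cyl_set_borel[OF B]
  show "{\<omega> \<in> space M. (\<lambda>i\<in>{..<n}. Z (f i) \<omega>) \<in> B} \<in> sets M" by measurable
  show "{\<omega> \<in> space M. V \<omega> \<in> cyl_set n f B} \<in> sets M" by measurable
  show "AE \<omega> in M. (\<omega> \<in> {\<omega> \<in> space M. (\<lambda>i\<in>{..<n}. Z (f i) \<omega>) \<in> B}) =
      (\<omega> \<in> {\<omega> \<in> space M. V \<omega> \<in> cyl_set n f B})"
    using ae
  proof eventually_elim
    case (elim \<omega>)
    then have "(\<lambda>i\<in>{..<n}. Z (f i) \<omega>) = (\<lambda>i\<in>{..<n}. f i (V \<omega>))"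
      using f by (intro restrict_ext) auto
    then show ?case by (simp add: cyl_set_def)
  qed
qed

text \<open>
  Two representations of one cylinder set together use finitely many functionals, and a random
  vector that realizes \<open>Z\<close> on all of them turns both events into membership in the same set of
  vectors.
\<close>

lemma cyl_distr_cyl_set:
  fixes Z :: "('v::{real_normed_vector,second_countable_topology} \<Rightarrow>\<^sub>L real) \<Rightarrow> 'w \<Rightarrow> real"
  assumes Z: "linear_process M Z" and B: "B \<in> sets (\<Pi>\<^sub>M i\<in>{..<n}. (borel :: real measure))"
  shows "cyl_distr M Z (cyl_set n f B) = emeasure M {\<omega> \<in> space M. (\<lambda>i\<in>{..<n}. Z (f i) \<omega>) \<in> B}"
  unfolding cyl_distr_def
proof (rule the_equality)
  show "\<exists>m g D. D \<in> sets (\<Pi>\<^sub>M i\<in>{..<m}. (borel :: real measure)) \<and> cyl_set n f B = cyl_set m g D \<and>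
    emeasure M {\<omega> \<in> space M. (\<lambda>i\<in>{..<n}. Z (f i) \<omega>) \<in> B} =
    emeasure M {\<omega> \<in> space M. (\<lambda>i\<in>{..<m}. Z (g i) \<omega>) \<in> D}"
    using B by blast
next
  fix p
  assume "\<exists>m g D. D \<in> sets (\<Pi>\<^sub>M i\<in>{..<m}. (borel :: real measure)) \<and> cyl_set n f B = cyl_set m g D \<and>
    p = emeasure M {\<omega> \<in> space M. (\<lambda>i\<in>{..<m}. Z (g i) \<omega>) \<in> D}"
  then obtain m g D where D: "D \<in> sets (\<Pi>\<^sub>M i\<in>{..<m}. (borel :: real measure))"
    and eq: "cyl_set n f B = cyl_set m g D"
    and p: "p = emeasure M {\<omega> \<in> space M. (\<lambda>i\<in>{..<m}. Z (g i) \<omega>) \<in> D}" by blast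
  have "finite (f ` {..<n} \<union> g ` {..<m})" by simp
  from linear_process_realization[OF Z this] obtain V where V: "V \<in> borel_measurable M"
    "AE \<omega> in M. \<forall>h\<in>f ` {..<n} \<union> g ` {..<m}. Z h \<omega> = h (V \<omega>)" by blast
  show "p = emeasure M {\<omega> \<in> space M. (\<lambda>i\<in>{..<n}. Z (f i) \<omega>) \<in> B}"
    unfolding p emeasure_realized_cyl_set[OF Z V Un_upper1 B]
      emeasure_realized_cyl_set[OF Z V Un_upper2 D] eq ..
qed

lemma cyl_distr_realized:
  fixes Z :: "('v::{real_normed_vector,second_countable_topology} \<Rightarrow>\<^sub>L real) \<Rightarrow> 'w \<Rightarrow> real"
  assumes Z: "linear_process M Z" and V: "V \<in> borel_measurable M"
    and ae: "AE \<omega> in M. \<forall>f\<in>\<Gamma>. Z f \<omega> = f (V \<omega>)" and \<Gamma>: "finite \<Gamma>"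
    and A: "A \<in> sigma_sets UNIV (cyl_generator \<Gamma>)"
  shows "cyl_distr M Z A = emeasure (distr M (cyl_sigma \<Gamma>) V) A"
proof -
  from sigma_sets_cyl_generator[OF \<Gamma> A] obtain n f B where f: "f ` {..<n} = \<Gamma>"
    and B: "B \<in> sets (\<Pi>\<^sub>M i\<in>{..<n}. (borel :: real measure))" and A_eq: "A = cyl_set n f B" .
  have V': "V \<in> measurable M (cyl_sigma \<Gamma>)"
    by (rule measurable_into_cyl_sigma) (use V in measurable)
  have "cyl_distr M Z A = emeasure M {\<omega> \<in> space M. V \<omega> \<in> cyl_set n f B}"
    unfolding A_eq cyl_distr_cyl_set[OF Z B]
    by (rule emeasure_realized_cyl_set[OF Z V ae _ B]) (simp add: f)
  also have "{\<omega> \<in> space M. V \<omega> \<in> cyl_set n f B} = V -` A \<inter> space M" by (auto simp: A_eq)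
  finally show ?thesis using emeasure_distr[OF V'] A by simp
qed

lemma measure_space_cyl_distr:
  fixes Z :: "('v::{real_normed_vector,second_countable_topology} \<Rightarrow>\<^sub>L real) \<Rightarrow> 'w \<Rightarrow> real"
  assumes Z: "linear_process M Z" and \<Gamma>: "finite \<Gamma>"
  shows "measure_space UNIV (sigma_sets UNIV (cyl_generator \<Gamma>)) (cyl_distr M Z)"
proof -
  from linear_process_realization[OF Z \<Gamma>] obtain V where V: "V \<in> borel_measurable M"
    "AE \<omega> in M. \<forall>f\<in>\<Gamma>. Z f \<omega> = f (V \<omega>)" .
  have "measure_space UNIV (sigma_sets UNIV (cyl_generator \<Gamma>)) (cyl_distr M Z) =
    measure_space UNIV (sigma_sets UNIV (cyl_generator \<Gamma>)) (emeasure (distr M (cyl_sigma \<Gamma>) V))"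
    by (rule measure_space_eq) (auto simp: cyl_distr_realized[OF Z V \<Gamma>])
  also have "\<dots>"
    using measure_space[of "distr M (cyl_sigma \<Gamma>) V"] by simp
  finally show ?thesis .
qed

lemma emeasure_cyl_restrict:
  assumes "measure_space UNIV (sigma_sets UNIV (cyl_generator \<Gamma>)) \<eta>"
    and "A \<in> sigma_sets UNIV (cyl_generator \<Gamma>)"
  shows "emeasure (cyl_restrict \<eta> \<Gamma>) A = \<eta> A"
  using assms by (intro emeasure_measure_of[OF cyl_restrict_def])
    (auto simp: measure_space_def sets_cyl_restrict)

lemma cyl_restrict_cyl_distr:
  fixes Z :: "('v::{real_normed_vector,second_countable_topology} \<Rightarrow>\<^sub>L real) \<Rightarrow> 'w \<Rightarrow> real"
  assumes Z: "linear_process M Z" and V: "V \<in> borel_measurable M"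
    and ae: "AE \<omega> in M. \<forall>f\<in>\<Gamma>. Z f \<omega> = f (V \<omega>)" and \<Gamma>: "finite \<Gamma>"
  shows "cyl_restrict (cyl_distr M Z) \<Gamma> = distr M (cyl_sigma \<Gamma>) V"
  by (rule measure_eqI)
    (simp_all add: sets_cyl_restrict emeasure_cyl_restrict measure_space_cyl_distr[OF Z \<Gamma>]
      cyl_distr_realized[OF Z V ae \<Gamma>])

lemma distr_functional_cyl_distr:
  fixes Z :: "('v::{real_normed_vector,second_countable_topology} \<Rightarrow>\<^sub>L real) \<Rightarrow> 'w \<Rightarrow> real"
  assumes Z: "linear_process M Z"
  shows "distr (cyl_restrict (cyl_distr M Z) {f}) borel (blinfun_apply f) = distr M borel (Z f)"
proof -
  obtain V where V [measurable]: "V \<in> borel_measurable M"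
    and ae: "AE \<omega> in M. \<forall>g\<in>{f}. Z g \<omega> = g (V \<omega>)"
    by (rule linear_process_realization[OF Z, of "{f}"]) auto
  have V': "V \<in> measurable M (cyl_sigma {f})"
    by (rule measurable_into_cyl_sigma) (use V in measurable)
  have "distr (cyl_restrict (cyl_distr M Z) {f}) borel (blinfun_apply f) =
    distr M borel (\<lambda>\<omega>. f (V \<omega>))"
    unfolding cyl_restrict_cyl_distr[OF Z V ae finite.insertI[OF finite.emptyI]]
    by (subst distr_distr[OF measurable_functional_cyl_sigma V']) (auto simp: comp_def)
  also have "\<dots> = distr M borel (Z f)"
    by (rule distr_cong_AE)
      (use ae linear_process_measurable[OF Z] in \<open>auto intro: measurable_compose[OF V]\<close>)
  finally show ?thesis .
qed

lemma cyl_moment_cyl_distr: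
  fixes Z :: "('v::{real_normed_vector,second_countable_topology} \<Rightarrow>\<^sub>L real) \<Rightarrow> 'w \<Rightarrow> real"
  assumes Z: "linear_process M Z"
  shows "cyl_moment (cyl_distr M Z) p f = (\<integral>\<^sup>+\<omega>. ennreal (\<bar>Z f \<omega>\<bar> powr p) \<partial>M)"
proof -
  have m: "blinfun_apply f \<in> borel_measurable (cyl_restrict (cyl_distr M Z) {f})"
    using measurable_functional_cyl_sigma[of f "{f}"] by (simp cong: measurable_cong_sets add: sets_cyl_restrict_cong)
  have "cyl_moment (cyl_distr M Z) p f =
    (\<integral>\<^sup>+x. ennreal (\<bar>x\<bar> powr p) \<partial>distr (cyl_restrict (cyl_distr M Z) {f}) borel (blinfun_apply f))"
    unfolding cyl_moment_def by (subst nn_integral_distr[OF m]) auto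
  also have "\<dots> = (\<integral>\<^sup>+\<omega>. ennreal (\<bar>Z f \<omega>\<bar> powr p) \<partial>M)"
    unfolding distr_functional_cyl_distr[OF Z]
    by (subst nn_integral_distr) (auto intro: linear_process_measurable[OF Z])
  finally show ?thesis .
qed

lemma cyl_char_cyl_distr:
  fixes Z :: "('v::{real_normed_vector,second_countable_topology} \<Rightarrow>\<^sub>L real) \<Rightarrow> 'w \<Rightarrow> real"
  assumes Z: "linear_process M Z"
  shows "cyl_char (cyl_distr M Z) f = (\<integral>\<omega>. exp (\<i> * complex_of_real (Z f \<omega>)) \<partial>M)"
proof -
  have m: "blinfun_apply f \<in> borel_measurable (cyl_restrict (cyl_distr M Z) {f})"
    using measurable_functional_cyl_sigma[of f "{f}"] by (simp cong: measurable_cong_sets add: sets_cyl_restrict_cong)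
  have "cyl_char (cyl_distr M Z) f =
    (\<integral>x. exp (\<i> * complex_of_real x) \<partial>distr (cyl_restrict (cyl_distr M Z) {f}) borel (blinfun_apply f))"
    unfolding cyl_char_def by (subst integral_distr[OF m]) auto
  also have "\<dots> = (\<integral>\<omega>. exp (\<i> * complex_of_real (Z f \<omega>)) \<partial>M)"
    unfolding distr_functional_cyl_distr[OF Z]
    by (subst integral_distr) (auto intro: linear_process_measurable[OF Z])
  finally show ?thesis .
qed

lemma norm_iexp_diff_le:
  fixes s t :: real
  shows "cmod (exp (\<i> * complex_of_real s) - exp (\<i> * complex_of_real t)) \<le> \<bar>s - t\<bar>"
proof -
  have "exp (\<i> * complex_of_real s) = exp (\<i> * complex_of_real t) * exp (\<i> * complex_of_real (s - t))"
    by (simp add: algebra_simps flip: exp_add)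
  then have "cmod (exp (\<i> * complex_of_real s) - exp (\<i> * complex_of_real t)) =
      cmod (exp (\<i> * complex_of_real t)) * cmod (exp (\<i> * complex_of_real (s - t)) - 1)"
    unfolding norm_mult[symmetric] by (simp add: algebra_simps)
  also have "\<dots> \<le> \<bar>s - t\<bar>"
    using iexp_approx1[of "s - t" 0] by (simp add: norm_exp_i_times)
  finally show ?thesis .
qed

lemma (in prob_space) square_integral_abs_le:
  assumes [measurable]: "Y \<in> borel_measurable M" and Y: "integrable M (\<lambda>\<omega>. (Y \<omega>)\<^sup>2)"
  shows "(\<integral>\<omega>. \<bar>Y \<omega>\<bar> \<partial>M) \<le> sqrt (\<integral>\<omega>. (Y \<omega>)\<^sup>2 \<partial>M)" "integrable M Y"
proof -
  show "integrable M Y" using square_integrable_imp_integrable[of Y] Y by simp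
  have "(\<integral>\<omega>. \<bar>Y \<omega>\<bar> \<partial>M)\<^sup>2 \<le> (\<integral>\<omega>. \<bar>Y \<omega>\<bar>\<^sup>2 \<partial>M)"
    using variance_positive[of "\<lambda>\<omega>. \<bar>Y \<omega>\<bar>"] variance_eq[of "\<lambda>\<omega>. \<bar>Y \<omega>\<bar>"] \<open>integrable M Y\<close> Y by auto
  then show "(\<integral>\<omega>. \<bar>Y \<omega>\<bar> \<partial>M) \<le> sqrt (\<integral>\<omega>. (Y \<omega>)\<^sup>2 \<partial>M)"
    by (intro real_le_rsqrt) simp
qed

text \<open>
  The bound on second moments makes the characteristic function Lipschitz:
  \<open>\<bar>E[exp(i Z f)] - E[exp(i Z g)]\<bar> \<le> E\<bar>Z (f - g)\<bar> \<le> \<parallel>f - g\<parallel>\<close>.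
\<close>

lemma cylindrical_prob_cyl_distr:
  fixes Z :: "('v::{real_normed_vector,second_countable_topology} \<Rightarrow>\<^sub>L real) \<Rightarrow> 'w \<Rightarrow> real"
  assumes M: "prob_space M" and Z: "linear_process M Z"
    and L2: "\<And>f. integrable M (\<lambda>\<omega>. (Z f \<omega>)\<^sup>2)" "\<And>f. (\<integral>\<omega>. (Z f \<omega>)\<^sup>2 \<partial>M) \<le> (norm f)\<^sup>2"
  shows "cylindrical_prob (cyl_distr M Z)"
proof -
  interpret prob_space M by fact
  note [measurable] = linear_process_measurable[OF Z]
  have "cyl_distr M Z UNIV = 1"
  proof -
    \<comment> \<open>The whole space is the cylinder set over no functionals, with the one-point space as base.\<close>
    let ?P = "\<Pi>\<^sub>M i\<in>{..<0::nat}. (borel :: real measure)" and ?f = "\<lambda>_::nat. 0 :: 'v \<Rightarrow>\<^sub>L real"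
    have "cyl_set 0 ?f (space ?P) = UNIV" by (auto simp: cyl_set_def space_PiM)
    then have "cyl_distr M Z UNIV = emeasure M {\<omega> \<in> space M. (\<lambda>i\<in>{..<0}. Z (?f i) \<omega>) \<in> space ?P}"
      using cyl_distr_cyl_set[OF Z sets.top, of 0 ?f] by metis
    also have "{\<omega> \<in> space M. (\<lambda>i\<in>{..<0}. Z (?f i) \<omega>) \<in> space ?P} = space M"
      by (auto simp: space_PiM)
    finally show ?thesis by (simp add: emeasure_space_1)
  qed
  moreover have "continuous_on UNIV (cyl_char (cyl_distr M Z))"
  proof (rule continuous_on_subset[OF lipschitz_on_continuous_on subset_refl], rule lipschitz_onI)
    fix f g :: "'v \<Rightarrow>\<^sub>L real"
    have ae: "AE \<omega> in M. Z (f - g) \<omega> = Z f \<omega> - Z g \<omega>"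
      using linear_process_combination[OF Z, of 1 f "-1" g] by simp
    have [simp]: "integrable M (\<lambda>\<omega>. exp (\<i> * complex_of_real (Z h \<omega>)))" for h
      by (rule integrable_const_bound[of _ 1]) auto
    have [simp]: "integrable M (Z h)" for h
      using L2(1) by (rule square_integral_abs_le(2)[rotated]) measurable
    have "dist (cyl_char (cyl_distr M Z) f) (cyl_char (cyl_distr M Z) g) =
      cmod (\<integral>\<omega>. exp (\<i> * complex_of_real (Z f \<omega>)) - exp (\<i> * complex_of_real (Z g \<omega>)) \<partial>M)"
      by (simp add: cyl_char_cyl_distr[OF Z] dist_norm)
    also have "\<dots> \<le> (\<integral>\<omega>. cmod (exp (\<i> * complex_of_real (Z f \<omega>)) - exp (\<i> * complex_of_real (Z g \<omega>))) \<partial>M)"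
      by (rule integral_norm_bound)
    also have "\<dots> \<le> (\<integral>\<omega>. \<bar>Z f \<omega> - Z g \<omega>\<bar> \<partial>M)"
      by (intro integral_mono norm_iexp_diff_le integrable_norm integrable_abs
          Bochner_Integration.integrable_diff) simp_all
    also have "\<dots> = (\<integral>\<omega>. \<bar>Z (f - g) \<omega>\<bar> \<partial>M)"
      by (rule integral_cong_AE) (use ae in auto)
    also have "\<dots> \<le> sqrt (\<integral>\<omega>. (Z (f - g) \<omega>)\<^sup>2 \<partial>M)"
      using L2(1) by (rule square_integral_abs_le(1)[rotated]) measurable
    also have "\<dots> \<le> norm (f - g)"
      using real_sqrt_le_mono[OF L2(2)[of "f - g"]] by simp
    finally show "dist (cyl_char (cyl_distr M Z) f) (cyl_char (cyl_distr M Z) g) \<le> 1 * dist f g"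
      by (simp add: dist_norm)
  qed simp
  ultimately show ?thesis
    unfolding cylindrical_prob_def using measure_space_cyl_distr[OF Z] by blast
qed

section \<open>Series in mean square\<close>

lemma power2_combination_le: "(a * u + b * v)\<^sup>2 \<le> 2 * a\<^sup>2 * u\<^sup>2 + 2 * b\<^sup>2 * (v\<^sup>2 :: real)"
  using zero_le_power2[of "a * u - b * v"] by (simp add: power2_eq_square algebra_simps)

lemma square_integrable_combination:
  assumes "square_integrable M Y" "square_integrable M Z"
  shows "square_integrable M (\<lambda>\<omega>. a * Y \<omega> + b * Z \<omega>)"
proof -
  have [measurable]: "Y \<in> borel_measurable M" "Z \<in> borel_measurable M"
    using assms by (auto simp: square_integrable_def)
  have "integrable M (\<lambda>\<omega>. (a * Y \<omega> + b * Z \<omega>)\<^sup>2)"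
  proof (rule Bochner_Integration.integrable_bound)
    show "integrable M (\<lambda>\<omega>. 2 * a\<^sup>2 * (Y \<omega>)\<^sup>2 + 2 * b\<^sup>2 * (Z \<omega>)\<^sup>2)"
      using assms by (auto simp: square_integrable_def)
  qed (auto intro!: AE_I2 order_trans[OF power2_combination_le])
  then show ?thesis by (simp add: square_integrable_def)
qed

lemma square_integrable_scale: "square_integrable M Y \<Longrightarrow> square_integrable M (\<lambda>\<omega>. a * Y \<omega>)"
  using square_integrable_combination[of M Y Y a 0] by simp

lemma square_integrable_diff:
  "square_integrable M Y \<Longrightarrow> square_integrable M Z \<Longrightarrow> square_integrable M (\<lambda>\<omega>. Y \<omega> - Z \<omega>)"
  using square_integrable_combination[of M Y Z 1 "-1"] by simp

lemma square_integrable_sum: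
  "(\<And>i. i \<in> I \<Longrightarrow> square_integrable M (Y i)) \<Longrightarrow> square_integrable M (\<lambda>\<omega>. \<Sum>i\<in>I. Y i \<omega>)"
proof (induction I rule: infinite_finite_induct)
  case (insert i I)
  then show ?case
    using square_integrable_combination[of M "Y i" "\<lambda>\<omega>. \<Sum>i\<in>I. Y i \<omega>" 1 1] by simp
qed (auto simp: square_integrable_def)

lemma square_integral_combination_le:
  assumes "square_integrable M Y" "square_integrable M Z"
  shows "(\<integral>\<omega>. (a * Y \<omega> + b * Z \<omega>)\<^sup>2 \<partial>M) \<le> 2 * a\<^sup>2 * (\<integral>\<omega>. (Y \<omega>)\<^sup>2 \<partial>M) + 2 * b\<^sup>2 * (\<integral>\<omega>. (Z \<omega>)\<^sup>2 \<partial>M)"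
proof -
  have "(\<integral>\<omega>. (a * Y \<omega> + b * Z \<omega>)\<^sup>2 \<partial>M) \<le> (\<integral>\<omega>. 2 * a\<^sup>2 * (Y \<omega>)\<^sup>2 + 2 * b\<^sup>2 * (Z \<omega>)\<^sup>2 \<partial>M)"
    using assms square_integrable_combination[OF assms, of a b]
    by (intro integral_mono power2_combination_le) (auto simp: square_integrable_def)
  also have "\<dots> = 2 * a\<^sup>2 * (\<integral>\<omega>. (Y \<omega>)\<^sup>2 \<partial>M) + 2 * b\<^sup>2 * (\<integral>\<omega>. (Z \<omega>)\<^sup>2 \<partial>M)"
    using assms by (subst Bochner_Integration.integral_add) (auto simp: square_integrable_def)
  finally show ?thesis .
qed

lemma L2_sums_partial:
  assumes "L2_sums M Y S"
  shows "square_integrable M (\<lambda>\<omega>. (\<Sum>k<n. Y k \<omega>))" "square_integrable M S"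
    "square_integrable M (\<lambda>\<omega>. (\<Sum>k<n. Y k \<omega>) - S \<omega>)"
  using assms by (auto simp: L2_sums_def intro!: square_integrable_diff square_integrable_sum)

lemma L2_sums_combination:
  assumes S: "L2_sums M Y S" and T: "L2_sums M Z T"
  shows "L2_sums M (\<lambda>k \<omega>. a * Y k \<omega> + b * Z k \<omega>) (\<lambda>\<omega>. a * S \<omega> + b * T \<omega>)"
proof -
  let ?d = "\<lambda>n \<omega>. (\<Sum>k<n. Y k \<omega>) - S \<omega>" and ?d' = "\<lambda>n \<omega>. (\<Sum>k<n. Z k \<omega>) - T \<omega>"
  let ?D = "\<lambda>n \<omega>. (\<Sum>k<n. a * Y k \<omega> + b * Z k \<omega>) - (a * S \<omega> + b * T \<omega>)"
  have D: "?D n \<omega> = a * ?d n \<omega> + b * ?d' n \<omega>" for n \<omega>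
    by (auto simp: sum.distrib algebra_simps sum_distrib_left)
  have le: "(\<integral>\<omega>. (?D n \<omega>)\<^sup>2 \<partial>M) \<le> 2 * a\<^sup>2 * (\<integral>\<omega>. (?d n \<omega>)\<^sup>2 \<partial>M) + 2 * b\<^sup>2 * (\<integral>\<omega>. (?d' n \<omega>)\<^sup>2 \<partial>M)" for n
    unfolding D by (intro square_integral_combination_le L2_sums_partial S T)
  have "(\<lambda>n. \<integral>\<omega>. (?D n \<omega>)\<^sup>2 \<partial>M) \<longlonglongrightarrow> 0"
  proof (rule tendsto_sandwich[OF _ _ tendsto_const])
    show "(\<lambda>n. 2 * a\<^sup>2 * (\<integral>\<omega>. (?d n \<omega>)\<^sup>2 \<partial>M) + 2 * b\<^sup>2 * (\<integral>\<omega>. (?d' n \<omega>)\<^sup>2 \<partial>M)) \<longlonglongrightarrow> 0"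
      using S T by (auto simp: L2_sums_def intro!: tendsto_add_zero tendsto_mult_right_zero)
  qed (auto simp: le)
  then show ?thesis
    using S T unfolding L2_sums_def by (auto intro!: square_integrable_combination)
qed

lemma L2_sums_sum:
  assumes "\<And>i. i < m \<Longrightarrow> L2_sums M (Y i) (S i)"
  shows "L2_sums M (\<lambda>k \<omega>. \<Sum>i<m::nat. Y i k \<omega>) (\<lambda>\<omega>. \<Sum>i<m. S i \<omega>)"
  using assms
proof (induction m)
  case 0
  show ?case by (simp add: L2_sums_def square_integrable_def)
next
  case (Suc m)
  then show ?case using L2_sums_combination[of M _ _ "Y m" "S m" 1 1] by simp
qed

lemma L2_sums_unique:
  assumes S: "L2_sums M Y S" and T: "L2_sums M Y T"
  shows "AE \<omega> in M. S \<omega> = T \<omega>"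
proof -
  have "L2_sums M (\<lambda>k \<omega>. 0) (\<lambda>\<omega>. S \<omega> - T \<omega>)"
    using L2_sums_combination[OF S T, of 1 "-1"] by simp
  then have "(\<integral>\<omega>. (S \<omega> - T \<omega>)\<^sup>2 \<partial>M) = 0" and "integrable M (\<lambda>\<omega>. (S \<omega> - T \<omega>)\<^sup>2)"
    by (auto simp: L2_sums_def square_integrable_def power2_commute LIMSEQ_const_iff)
  then have "AE \<omega> in M. (S \<omega> - T \<omega>)\<^sup>2 = 0"
    by (subst (asm) integral_nonneg_eq_0_iff_AE) auto
  then show ?thesis by simp
qed

text \<open>
  Convergence in \<open>L\<^sup>2\<close> is a property of joint laws: a series on the image space pulls back to a
  series on the original space.
\<close>

lemma L2_sums_distr:
  assumes \<phi> [measurable]: "\<phi> \<in> measurable M N" and S: "L2_sums (distr M N \<phi>) Y S"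
  shows "L2_sums M (\<lambda>k \<omega>. Y k (\<phi> \<omega>)) (\<lambda>\<omega>. S (\<phi> \<omega>))"
proof -
  have [measurable]: "Y k \<in> borel_measurable N" "S \<in> borel_measurable N" for k
    using S by (auto simp: L2_sums_def square_integrable_def)
  have pull: "square_integrable M (\<lambda>\<omega>. F (\<phi> \<omega>))" if "square_integrable (distr M N \<phi>) F" for F
    using that by (auto simp: square_integrable_def integrable_distr_eq)
  have "(\<integral>x. ((\<Sum>k<n. Y k x) - S x)\<^sup>2 \<partial>distr M N \<phi>) = (\<integral>\<omega>. ((\<Sum>k<n. Y k (\<phi> \<omega>)) - S (\<phi> \<omega>))\<^sup>2 \<partial>M)" for n
    by (rule integral_distr) measurable
  with S pull show ?thesis by (simp add: L2_sums_def)
qed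

text \<open>
  Continuity of the \<open>L\<^sup>2\<close> norm.
\<close>

lemma L2_sums_square_integral:
  assumes S: "L2_sums M Y S"
  shows "(\<lambda>n. \<integral>\<omega>. (\<Sum>k<n. Y k \<omega>)\<^sup>2 \<partial>M) \<longlonglongrightarrow> (\<integral>\<omega>. (S \<omega>)\<^sup>2 \<partial>M)"
proof -
  define \<delta> where "\<delta> n = (\<integral>\<omega>. ((\<Sum>k<n. Y k \<omega>) - S \<omega>)\<^sup>2 \<partial>M)" for n
  define B where "B = (\<integral>\<omega>. (S \<omega>)\<^sup>2 \<partial>M)"
  \<comment> \<open>For every \<open>\<epsilon> > 0\<close>, \<open>\<bar>s\<^sup>2 - b\<^sup>2\<bar> \<le> \<epsilon> b\<^sup>2 + (1 + 1/\<epsilon>) (s - b)\<^sup>2\<close>. The choice of order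
      \<open>\<surd>\<delta>\<close> makes both terms small; the summand \<open>1/(n+1)\<close> only keeps \<open>\<epsilon>\<close> positive.\<close>
  define \<epsilon> where "\<epsilon> n = sqrt (\<delta> n) + inverse (real (Suc n))" for n
  have \<delta>0: "\<delta> n \<ge> 0" and B0: "B \<ge> 0" for n by (auto simp: \<delta>_def B_def)
  then have \<epsilon>: "\<epsilon> n > 0" "sqrt (\<delta> n) \<le> \<epsilon> n" for n
    by (auto simp: \<epsilon>_def intro!: add_nonneg_pos)
  have \<delta>_lim: "\<delta> \<longlonglongrightarrow> 0" using S by (simp add: L2_sums_def \<delta>_def[abs_def])
  then have \<epsilon>_lim: "\<epsilon> \<longlonglongrightarrow> 0"
    unfolding \<epsilon>_def[abs_def] using tendsto_real_sqrt[OF \<delta>_lim]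
    by (intro tendsto_add_zero LIMSEQ_inverse_real_of_nat) simp
  have sq: "integrable M (\<lambda>\<omega>. (\<Sum>k<n. Y k \<omega>)\<^sup>2)" "integrable M (\<lambda>\<omega>. (S \<omega>)\<^sup>2)"
      "integrable M (\<lambda>\<omega>. ((\<Sum>k<n. Y k \<omega>) - S \<omega>)\<^sup>2)" for n
    using L2_sums_partial[OF S] by (auto simp: square_integrable_def)
  have bound: "\<bar>(\<integral>\<omega>. (\<Sum>k<n. Y k \<omega>)\<^sup>2 \<partial>M) - B\<bar> \<le> \<epsilon> n * B + \<delta> n + sqrt (\<delta> n)" for n
  proof -
    have pt: "\<bar>s\<^sup>2 - b\<^sup>2\<bar> \<le> \<epsilon> n * b\<^sup>2 + (1 + 1 / \<epsilon> n) * (s - b)\<^sup>2" for s b :: real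
    proof -
      have "0 \<le> (\<bar>\<epsilon> n * b\<bar> - \<bar>s - b\<bar>)\<^sup>2" by simp
      then have "2 * \<epsilon> n * \<bar>b * (s - b)\<bar> \<le> (\<epsilon> n)\<^sup>2 * b\<^sup>2 + (s - b)\<^sup>2"
        using \<epsilon>(1)[of n] by (simp add: power2_diff power_mult_distrib abs_mult)
      then have "2 * \<bar>b * (s - b)\<bar> \<le> \<epsilon> n * b\<^sup>2 + (s - b)\<^sup>2 / \<epsilon> n"
        using \<epsilon>(1)[of n] by (simp add: field_simps power2_eq_square)
      moreover have "s\<^sup>2 - b\<^sup>2 = 2 * (b * (s - b)) + (s - b)\<^sup>2"
        by (simp add: power2_eq_square algebra_simps)
      then have "\<bar>s\<^sup>2 - b\<^sup>2\<bar> \<le> 2 * \<bar>b * (s - b)\<bar> + (s - b)\<^sup>2"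
        by (smt (verit) zero_le_power2)
      ultimately show ?thesis by (simp add: algebra_simps)
    qed
    have "\<bar>(\<integral>\<omega>. (\<Sum>k<n. Y k \<omega>)\<^sup>2 \<partial>M) - B\<bar> = \<bar>\<integral>\<omega>. (\<Sum>k<n. Y k \<omega>)\<^sup>2 - (S \<omega>)\<^sup>2 \<partial>M\<bar>"
      using sq by (simp add: B_def)
    also have "\<dots> \<le> (\<integral>\<omega>. \<bar>(\<Sum>k<n. Y k \<omega>)\<^sup>2 - (S \<omega>)\<^sup>2\<bar> \<partial>M)" by (rule integral_abs_bound)
    also have "\<dots> \<le> (\<integral>\<omega>. \<epsilon> n * (S \<omega>)\<^sup>2 + (1 + 1 / \<epsilon> n) * ((\<Sum>k<n. Y k \<omega>) - S \<omega>)\<^sup>2 \<partial>M)"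
      using sq by (intro integral_mono pt) auto
    also have "\<dots> = \<epsilon> n * B + (1 + 1 / \<epsilon> n) * \<delta> n"
      using sq by (subst Bochner_Integration.integral_add) (auto simp: B_def \<delta>_def)
    also have "\<delta> n / \<epsilon> n \<le> sqrt (\<delta> n)"
    proof -
      have "\<delta> n = sqrt (\<delta> n) * sqrt (\<delta> n)" using \<delta>0 by simp
      also have "\<dots> \<le> sqrt (\<delta> n) * \<epsilon> n" using \<epsilon>(2) \<delta>0 by (intro mult_left_mono) auto
      finally show ?thesis using \<epsilon>(1)[of n] by (simp add: field_simps)
    qed
    then have "\<epsilon> n * B + (1 + 1 / \<epsilon> n) * \<delta> n \<le> \<epsilon> n * B + \<delta> n + sqrt (\<delta> n)"
      by (simp add: algebra_simps)
    finally show ?thesis .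
  qed
  have "(\<lambda>n. \<epsilon> n * B + \<delta> n + sqrt (\<delta> n)) \<longlonglongrightarrow> 0"
    using tendsto_real_sqrt[OF \<delta>_lim]
    by (intro tendsto_add_zero tendsto_mult_left_zero \<epsilon>_lim \<delta>_lim) simp
  then have "(\<lambda>n. (\<integral>\<omega>. (\<Sum>k<n. Y k \<omega>)\<^sup>2 \<partial>M) - B) \<longlonglongrightarrow> 0"
    by (rule Lim_null_comparison[rotated]) (use bound in auto)
  then show ?thesis unfolding B_def by (rule LIM_zero_cancel)
qed

text \<open>
  The condition says that \<open>c \<mapsto> \<Sum>\<^sub>k c\<^sub>k y\<^sub>k\<close> is a contraction from finite sequences with the \<open>\<ell>\<^sup>2\<close> norm
  into \<open>L\<^sup>2\<close>, that is, \<open>y\<close> is a Bessel sequence with bound 1.  Orthonormal sequences satisfy it with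
  equality; the inequality is what passes to convolution roots.
\<close>

definition bessel_sequence :: "'w measure \<Rightarrow> (nat \<Rightarrow> 'w \<Rightarrow> real) \<Rightarrow> bool" where
  "bessel_sequence M y \<longleftrightarrow>
     (\<forall>k. square_integrable M (y k)) \<and>
     (\<forall>c n. (\<integral>\<omega>. (\<Sum>k<n. c k * y k \<omega>)\<^sup>2 \<partial>M) \<le> (\<Sum>k<n. (c k)\<^sup>2))"

text \<open>
  The Riesz-Fischer argument: along a subsequence of the partial sums whose increments are summable
  in \<open>L\<^sup>1\<close> there is almost sure convergence, and Fatou's lemma shows that the pointwise limit is also
  the limit in \<open>L\<^sup>2\<close> of the full sequence.
\<close>

lemma (in prob_space) L2_sums_exists:
  assumes y: "bessel_sequence M y" and c: "summable (\<lambda>k. (c k)\<^sup>2)"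
  shows "\<exists>S. L2_sums M (\<lambda>k \<omega>. c k * y k \<omega>) S"
proof -
  have sq_y: "square_integrable M (y k)" for k using y by (simp add: bessel_sequence_def)
  define s where "s n \<omega> = (\<Sum>k<n. c k * y k \<omega>)" for n \<omega>
  have sq_s: "square_integrable M (s n)" for n
    unfolding s_def by (intro square_integrable_sum square_integrable_scale sq_y)
  then have s_meas [measurable]: "s n \<in> borel_measurable M" for n
    by (simp add: square_integrable_def)
  have sq_d: "integrable M (\<lambda>\<omega>. (s n \<omega> - s m \<omega>)\<^sup>2)" for n m
    using square_integrable_diff[OF sq_s sq_s] by (simp add: square_integrable_def)
  define R where "R m = (\<Sum>k. (c (k + m))\<^sup>2)" for m
  have R_lim: "R \<longlonglongrightarrow> 0" unfolding R_def using suminf_exist_split2[OF c] by simp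
  have increment: "(\<integral>\<omega>. (s n \<omega> - s m \<omega>)\<^sup>2 \<partial>M) \<le> R m" if "m \<le> n" for m n
  proof -
    \<comment> \<open>The Bessel bound speaks of sums from 0; zero coefficients cut off the initial part.\<close>
    define c' where "c' k = (if k < m then 0 else c k)" for k
    have split: "(\<Sum>k<n. f k) = (\<Sum>k<m. f k) + (\<Sum>k=m..<n. f k)" for f :: "nat \<Rightarrow> real"
      using that by (metis atLeast0LessThan sum.atLeastLessThan_concat zero_le)
    have "(\<Sum>k<n. c' k * y k \<omega>) = s n \<omega> - s m \<omega>" for \<omega>
      unfolding s_def by (simp add: split c'_def)
    then have "(\<integral>\<omega>. (s n \<omega> - s m \<omega>)\<^sup>2 \<partial>M) = (\<integral>\<omega>. (\<Sum>k<n. c' k * y k \<omega>)\<^sup>2 \<partial>M)"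
      by simp
    also have "\<dots> \<le> (\<Sum>k<n. (c' k)\<^sup>2)"
      using y unfolding bessel_sequence_def by blast
    also have "\<dots> = (\<Sum>k=m..<n. (c k)\<^sup>2)" by (simp add: split c'_def)
    also have "\<dots> = (\<Sum>k<n - m. (c (k + m))\<^sup>2)"
      using sum.shift_bounds_nat_ivl[of "\<lambda>k. (c k)\<^sup>2" 0 m "n - m"] that by (simp add: atLeast0LessThan)
    also have "\<dots> \<le> R m"
      unfolding R_def by (intro sum_le_suminf summable_ignore_initial_segment[OF c]) auto
    finally show ?thesis .
  qed
  have "\<forall>i. \<exists>N. \<forall>n\<ge>N. R n \<le> (1 / 4) ^ i"
  proof
    fix i :: nat
    have "eventually (\<lambda>n. R n < (1 / 4) ^ i) sequentially"
      using R_lim by (rule order_tendstoD) simp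
    then show "\<exists>N. \<forall>n\<ge>N. R n \<le> (1 / 4) ^ i"
      by (auto simp: eventually_sequentially intro: less_imp_le)
  qed
  then obtain N where N: "\<And>i n. N i \<le> n \<Longrightarrow> R n \<le> (1 / 4) ^ i" by metis
  \<comment> \<open>Summing the thresholds makes the subsequence monotone without a recursive choice.\<close>
  define r where "r i = (\<Sum>l\<le>i. N l) + i" for i
  have r_Suc: "r i \<le> r (Suc i)" and r_ge: "i \<le> r i" for i by (auto simp: r_def)
  have R_r: "R (r i) \<le> (1 / 4) ^ i" for i
  proof (rule N)
    have "N i \<le> (\<Sum>l\<le>i. N l)" by (rule member_le_sum) auto
    then show "N i \<le> r i" by (simp add: r_def)
  qed
  define D where "D i \<omega> = s (r (Suc i)) \<omega> - s (r i) \<omega>" for i \<omega>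
  have D_meas [measurable]: "D i \<in> borel_measurable M" for i unfolding D_def by measurable
  have D_sq: "integrable M (\<lambda>\<omega>. (D i \<omega>)\<^sup>2)" for i unfolding D_def by (rule sq_d)
  have D_int: "integrable M (D i)" for i
    using D_sq by (rule square_integral_abs_le(2)[OF D_meas])
  have D_L1: "(\<integral>\<omega>. \<bar>D i \<omega>\<bar> \<partial>M) \<le> (1 / 2) ^ i" for i
  proof -
    have "(\<integral>\<omega>. \<bar>D i \<omega>\<bar> \<partial>M) \<le> sqrt (\<integral>\<omega>. (D i \<omega>)\<^sup>2 \<partial>M)"
      using D_sq by (rule square_integral_abs_le(1)[OF D_meas])
    also have "\<dots> \<le> sqrt ((1 / 4) ^ i)"
      unfolding D_def using increment[OF r_Suc] R_r[of i] by (intro real_sqrt_le_mono) (rule order_trans)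
    also have "\<dots> = (1 / 2) ^ i" by (simp add: real_sqrt_power real_sqrt_divide)
    finally show ?thesis .
  qed
  have "(\<integral>\<^sup>+\<omega>. (\<Sum>i. ennreal \<bar>D i \<omega>\<bar>) \<partial>M) = (\<Sum>i. \<integral>\<^sup>+\<omega>. ennreal \<bar>D i \<omega>\<bar> \<partial>M)"
    by (rule nn_integral_suminf) measurable
  also have "\<dots> = (\<Sum>i. ennreal (\<integral>\<omega>. \<bar>D i \<omega>\<bar> \<partial>M))"
    using D_int by (subst nn_integral_eq_integral) auto
  also have "\<dots> \<le> (\<Sum>i. ennreal ((1 / 2) ^ i))"
    by (intro suminf_le ennreal_leI D_L1) auto
  also have "\<dots> = ennreal (\<Sum>i. (1 / 2) ^ i)"
    by (rule suminf_ennreal2) (auto intro!: summable_geometric)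
  also have "\<dots> < \<infinity>" by simp
  finally have "AE \<omega> in M. (\<Sum>i. ennreal \<bar>D i \<omega>\<bar>) \<noteq> \<infinity>"
    by (intro nn_integral_PInf_AE) auto
  then have conv: "AE \<omega> in M. convergent (\<lambda>i. s (r i) \<omega>)"
  proof eventually_elim
    case (elim \<omega>)
    then have "summable (\<lambda>i. \<bar>D i \<omega>\<bar>)" by (intro summable_suminf_not_top) auto
    then have "summable (\<lambda>i. D i \<omega>)" by (rule summable_rabs_cancel)
    then have "convergent (\<lambda>n. \<Sum>i<n. D i \<omega>)" by (simp add: summable_iff_convergent)
    moreover have "(\<Sum>i<n. D i \<omega>) = s (r n) \<omega> - s (r 0) \<omega>" for n
      unfolding D_def by (rule sum_lessThan_telescope)
    ultimately show ?case
      using convergent_add_const_iff[of "- s (r 0) \<omega>" "\<lambda>i. s (r i) \<omega>"] by simp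
  qed
  define S where "S \<omega> = lim (\<lambda>i. s (r i) \<omega>)" for \<omega>
  have S_meas [measurable]: "S \<in> borel_measurable M"
    unfolding S_def[abs_def] by measurable
  have fatou: "(\<integral>\<^sup>+\<omega>. ennreal ((s n \<omega> - S \<omega>)\<^sup>2) \<partial>M) \<le> ennreal (R n)" for n
  proof -
    have "(\<integral>\<^sup>+\<omega>. ennreal ((s n \<omega> - S \<omega>)\<^sup>2) \<partial>M) =
        (\<integral>\<^sup>+\<omega>. liminf (\<lambda>i. ennreal ((s (r i) \<omega> - s n \<omega>)\<^sup>2)) \<partial>M)"
    proof (rule nn_integral_cong_AE, use conv in eventually_elim)
      fix \<omega> assume "convergent (\<lambda>i. s (r i) \<omega>)"
      then have "(\<lambda>i. s (r i) \<omega>) \<longlonglongrightarrow> S \<omega>" unfolding S_def by (simp add: convergent_LIMSEQ_iff)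
      then have "(\<lambda>i. ennreal ((s (r i) \<omega> - s n \<omega>)\<^sup>2)) \<longlonglongrightarrow> ennreal ((S \<omega> - s n \<omega>)\<^sup>2)"
        by (intro tendsto_ennrealI tendsto_intros)
      from lim_imp_Liminf[OF _ this]
      show "ennreal ((s n \<omega> - S \<omega>)\<^sup>2) = liminf (\<lambda>i. ennreal ((s (r i) \<omega> - s n \<omega>)\<^sup>2))"
        by (simp add: power2_commute)
    qed
    also have "\<dots> \<le> liminf (\<lambda>i. \<integral>\<^sup>+\<omega>. ennreal ((s (r i) \<omega> - s n \<omega>)\<^sup>2) \<partial>M)"
      by (rule nn_integral_liminf) measurable
    also have "\<dots> \<le> liminf (\<lambda>i. ennreal (R n))"
    proof (rule Liminf_mono, rule eventually_sequentiallyI)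
      fix i assume "n \<le> i"
      then have "n \<le> r i" using r_ge[of i] by linarith
      then show "(\<integral>\<^sup>+\<omega>. ennreal ((s (r i) \<omega> - s n \<omega>)\<^sup>2) \<partial>M) \<le> ennreal (R n)"
        using sq_d by (subst nn_integral_eq_integral) (auto intro!: ennreal_leI increment)
    qed
    also have "\<dots> = ennreal (R n)" by (simp add: Liminf_const)
    finally show ?thesis .
  qed
  have int: "integrable M (\<lambda>\<omega>. (s n \<omega> - S \<omega>)\<^sup>2)" for n
    using order.strict_trans1[OF fatou[of n]] by (intro integrableI_bounded) auto
  have "(\<integral>\<omega>. (s n \<omega> - S \<omega>)\<^sup>2 \<partial>M) \<le> R n" for n
  proof -
    have "0 \<le> R n" unfolding R_def by (intro suminf_nonneg summable_ignore_initial_segment[OF c]) simp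
    then show ?thesis using fatou[of n] int[of n] by (simp add: nn_integral_eq_integral)
  qed
  then have "(\<lambda>n. \<integral>\<omega>. (s n \<omega> - S \<omega>)\<^sup>2 \<partial>M) \<longlonglongrightarrow> 0"
    by (intro tendsto_sandwich[OF _ _ tendsto_const R_lim]) auto
  moreover have "square_integrable M S"
    using int[of 0] by (simp add: square_integrable_def s_def)
  ultimately show ?thesis
    using sq_y by (auto simp: L2_sums_def s_def intro!: exI[of _ S] square_integrable_scale)
qed

section \<open>Orthonormal bases and the Riesz isomorphism\<close>

lemma closed_linear_eq_on_basis:
  fixes f g :: "'h::real_inner \<Rightarrow> real"
  assumes e: "orthonormal_basis e" and f: "bounded_linear f" and g: "bounded_linear g"
    and eq: "\<And>k. f (e k) = g (e k)"
  shows "f x = g x"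
proof -
  have "closed {x. f x = g x}"
    by (intro closed_Collect_eq linear_continuous_on f g)
  moreover have "span (range e) \<subseteq> {x. f x = g x}"
    using linear_eq_on_span[OF bounded_linear.linear[OF f] bounded_linear.linear[OF g], of "range e"] eq by auto
  ultimately have "closure (span (range e)) \<subseteq> {x. f x = g x}" by (rule closure_minimal[rotated])
  then show ?thesis using e by (auto simp: orthonormal_basis_def)
qed

lemma orthonormal_norm_sum:
  assumes "orthonormal_basis e" "finite K"
  shows "(norm (\<Sum>k\<in>K. c k *\<^sub>R e k))\<^sup>2 = (\<Sum>k\<in>K. (c k)\<^sup>2)"
proof -
  have ee: "e k \<bullet> e l = (if k = l then 1 else 0)" for k l
    using assms(1) by (simp add: orthonormal_basis_def)
  show ?thesis
    using assms(2) unfolding power2_norm_eq_inner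
    by (simp add: ee inner_sum_left inner_sum_right if_distrib power2_eq_square cong: if_cong)
qed

text \<open>
  The Riesz representation theorem and Parseval's identity together: Bessel's inequality for the
  coefficients \<open>f e\<^sub>k\<close> comes from testing \<open>f\<close> on the partial sums of \<open>\<Sum>\<^sub>k (f e\<^sub>k) e\<^sub>k\<close>, and the sum of
  this series represents \<open>f\<close> on the basis, hence everywhere.
\<close>

lemma orthonormal_basis_functional:
  fixes f :: "'h::{real_inner,banach} \<Rightarrow>\<^sub>L real"
  assumes e: "orthonormal_basis e"
  obtains h where "\<And>x. f x = h \<bullet> x" "(\<lambda>k. (f (e k))\<^sup>2) sums (norm h)\<^sup>2"
    "(\<lambda>k. f (e k) *\<^sub>R e k) sums h"
proof -
  have ee: "e k \<bullet> e l = (if k = l then 1 else 0)" for k l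
    using e by (simp add: orthonormal_basis_def)
  define s where "s n = (\<Sum>k<n. f (e k) *\<^sub>R e k)" for n
  have bound: "(\<Sum>k<n. (f (e k))\<^sup>2) \<le> (norm f)\<^sup>2" for n
  proof -
    define p where "p = norm (s n)"
    have sq: "p\<^sup>2 = (\<Sum>k<n. (f (e k))\<^sup>2)" unfolding p_def s_def by (rule orthonormal_norm_sum[OF e]) simp
    also have "\<dots> = f (s n)"
      unfolding s_def by (simp add: blinfun.sum_right blinfun.scaleR_right power2_eq_square)
    also have "\<dots> \<le> norm f * p" unfolding p_def using norm_blinfun[of f "s n"] by simp
    finally have "p * p \<le> norm f * p" by (simp add: power2_eq_square)
    then have "p \<le> norm f" by (cases "p = 0") (auto simp: p_def)
    then show ?thesis unfolding sq[symmetric] by (intro power_mono) (auto simp: p_def)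
  qed
  have summ: "summable (\<lambda>k. (f (e k))\<^sup>2)"
    by (rule summableI_nonneg_bounded[OF _ bound]) simp
  have "summable (\<lambda>k. f (e k) *\<^sub>R e k)"
    unfolding summable_Cauchy
  proof (intro allI impI)
    fix \<epsilon> :: real assume "\<epsilon> > 0"
    then have "\<epsilon>\<^sup>2 > 0" by simp
    with summ obtain N where N: "\<And>m n. m \<ge> N \<Longrightarrow> norm (\<Sum>k=m..<n. (f (e k))\<^sup>2) < \<epsilon>\<^sup>2"
      unfolding summable_Cauchy by blast
    have "norm (\<Sum>k=m..<n. f (e k) *\<^sub>R e k) < \<epsilon>" if "m \<ge> N" for m n
    proof (rule power2_less_imp_less)
      show "(norm (\<Sum>k=m..<n. f (e k) *\<^sub>R e k))\<^sup>2 < \<epsilon>\<^sup>2"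
        using N[OF that, of n] by (simp add: orthonormal_norm_sum[OF e])
    qed (use \<open>\<epsilon> > 0\<close> in simp)
    then show "\<exists>N. \<forall>m\<ge>N. \<forall>n. norm (\<Sum>k=m..<n. f (e k) *\<^sub>R e k) < \<epsilon>" by blast
  qed
  then obtain h where h: "(\<lambda>k. f (e k) *\<^sub>R e k) sums h" by (auto simp: summable_def)
  then have lim: "s \<longlonglongrightarrow> h" unfolding s_def[abs_def] sums_def .
  have "h \<bullet> e l = f (e l)" for l
  proof (rule LIMSEQ_unique)
    show "(\<lambda>n. s n \<bullet> e l) \<longlonglongrightarrow> h \<bullet> e l" by (intro tendsto_intros lim)
    show "(\<lambda>n. s n \<bullet> e l) \<longlonglongrightarrow> f (e l)"
    proof (rule tendsto_eventually, rule eventually_sequentiallyI)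
      fix n assume "Suc l \<le> n"
      then show "s n \<bullet> e l = f (e l)"
        by (simp add: s_def inner_sum_left ee if_distrib cong: if_cong)
    qed
  qed
  then have "h \<bullet> x = f x" for x
    by (rule closed_linear_eq_on_basis[OF e bounded_linear_inner_right blinfun.bounded_linear_right])
  moreover have "(\<lambda>n. (norm (s n))\<^sup>2) \<longlonglongrightarrow> (norm h)\<^sup>2" by (intro tendsto_intros lim)
  then have "(\<lambda>k. (f (e k))\<^sup>2) sums (norm h)\<^sup>2"
    unfolding sums_def s_def by (simp add: orthonormal_norm_sum[OF e])
  ultimately show thesis using h by (intro that[of h]) simp_all
qed

lemma riesz_inner:
  fixes f :: "'h::{real_inner,banach} \<Rightarrow>\<^sub>L real"
  assumes "orthonormal_basis (e :: nat \<Rightarrow> 'h)"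
  shows "riesz f \<bullet> x = f x"
proof -
  obtain h where h: "\<And>x. f x = h \<bullet> x" by (rule orthonormal_basis_functional[OF assms, of f]) blast
  have "riesz f = h" unfolding riesz_def
  proof (rule the_equality)
    fix h' assume "\<forall>x. f x = h' \<bullet> x"
    then show "h' = h" using h by (metis vector_eq_rdot)
  qed (simp add: h)
  then show ?thesis by (simp add: h)
qed

lemma riesz_combination:
  assumes "orthonormal_basis (e :: nat \<Rightarrow> 'h::{real_inner,banach})"
  shows "riesz (a *\<^sub>R f + b *\<^sub>R g) = a *\<^sub>R riesz f + b *\<^sub>R (riesz g :: 'h)"
  by (subst vector_eq_rdot[symmetric])
    (simp add: riesz_inner[OF assms] inner_add_left blinfun.add_left blinfun.scaleR_left)

lemma norm_riesz:
  assumes "orthonormal_basis (e :: nat \<Rightarrow> 'h::{real_inner,banach})"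
  shows "norm (riesz f :: 'h) = norm f"
proof (rule antisym)
  have "norm (riesz f) * norm (riesz f) = f (riesz f)"
    using riesz_inner[OF assms, of f "riesz f"] by (simp flip: power2_norm_eq_inner add: power2_eq_square)
  also have "\<dots> \<le> norm f * norm (riesz f)" using norm_blinfun[of f "riesz f"] by simp
  finally show "norm (riesz f) \<le> norm f"
    by (cases "riesz f = 0") auto
  show "norm f \<le> norm (riesz f)"
    by (rule norm_blinfun_bound) (auto simp: riesz_inner[OF assms, symmetric] Cauchy_Schwarz_ineq2)
qed

text \<open>
  The case of the functional \<open>x \<mapsto> \<langle>x, h\<rangle>\<close>, whose representing vector is \<open>h\<close>.
\<close>

lemma orthonormal_basis_expansion:
  fixes h :: "'h::{real_inner,banach}"
  assumes e: "orthonormal_basis e"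
  shows "(\<lambda>k. (e k \<bullet> h) *\<^sub>R e k) sums h" "(\<lambda>k. (e k \<bullet> h)\<^sup>2) sums (norm h)\<^sup>2"
proof -
  obtain g where g: "\<And>x. blinfun_inner_left h x = g \<bullet> x"
    "(\<lambda>k. (blinfun_inner_left h (e k))\<^sup>2) sums (norm g)\<^sup>2"
    "(\<lambda>k. blinfun_inner_left h (e k) *\<^sub>R e k) sums g"
    by (rule orthonormal_basis_functional[OF e, of "blinfun_inner_left h"]) blast
  have "g = h" using g(1) by (subst vector_eq_rdot[symmetric]) (simp add: inner_commute)
  with g(2,3) show "(\<lambda>k. (e k \<bullet> h) *\<^sub>R e k) sums h" "(\<lambda>k. (e k \<bullet> h)\<^sup>2) sums (norm h)\<^sup>2"
    by (simp_all add: inner_commute)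
qed

section \<open>The cylindrical random variable of a Bessel sequence\<close>

text \<open>
  The series that defines \<open>\<Theta>\<^sub>X\<close>, with an arbitrary sequence \<open>y\<close> in place of \<open>(X v\<^sub>l\<^sup>*)\<^sub>l\<close>, so that it
  can also be formed with the coordinates of a law on the space of sequences.
\<close>

definition L2_series ::
  "'w measure \<Rightarrow> (nat \<Rightarrow> 'w \<Rightarrow> real) \<Rightarrow> (nat \<Rightarrow> 'h::real_inner) \<Rightarrow> 'h \<Rightarrow> 'w \<Rightarrow> real" where
  "L2_series M y e h = (SOME S. L2_sums M (\<lambda>k \<omega>. (e k \<bullet> h) * y k \<omega>) S)"

context prob_space
begin

lemma L2_sums_L2_series:
  fixes h :: "'h::{real_inner,banach}"
  assumes "bessel_sequence M y" "orthonormal_basis e"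
  shows "L2_sums M (\<lambda>k \<omega>. (e k \<bullet> h) * y k \<omega>) (L2_series M y e h)"
  unfolding L2_series_def
  using L2_sums_exists[OF assms(1) sums_summable[OF orthonormal_basis_expansion(2)[OF assms(2)]], of h]
  by (rule someI_ex)

lemma square_integrable_L2_series:
  fixes h :: "'h::{real_inner,banach}"
  assumes "bessel_sequence M y" "orthonormal_basis e"
  shows "square_integrable M (L2_series M y e h)"
  using L2_sums_L2_series[OF assms] by (simp add: L2_sums_def)

lemma L2_series_square_le:
  fixes h :: "'h::{real_inner,banach}"
  assumes y: "bessel_sequence M y" and e: "orthonormal_basis e"
  shows "(\<integral>\<omega>. (L2_series M y e h \<omega>)\<^sup>2 \<partial>M) \<le> (norm h)\<^sup>2"
proof (rule LIMSEQ_le)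
  show "(\<lambda>n. \<integral>\<omega>. (\<Sum>k<n. (e k \<bullet> h) * y k \<omega>)\<^sup>2 \<partial>M) \<longlonglongrightarrow> (\<integral>\<omega>. (L2_series M y e h \<omega>)\<^sup>2 \<partial>M)"
    by (intro L2_sums_square_integral L2_sums_L2_series y e)
  show "(\<lambda>n. \<Sum>k<n. (e k \<bullet> h)\<^sup>2) \<longlonglongrightarrow> (norm h)\<^sup>2"
    using orthonormal_basis_expansion(2)[OF e] by (simp add: sums_def)
qed (use y in \<open>auto simp: bessel_sequence_def\<close>)

lemma linear_process_L2_series:
  fixes e :: "nat \<Rightarrow> 'h::{real_inner,banach}"
  assumes y: "bessel_sequence M y" and e: "orthonormal_basis e"
  shows "linear_process M (\<lambda>f. L2_series M y e (riesz f))"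
  unfolding linear_process_def
proof (intro conjI allI)
  show "L2_series M y e (riesz f) \<in> borel_measurable M" for f
    using square_integrable_L2_series[OF y e] by (simp add: square_integrable_def)
  fix a b and f g :: "'h \<Rightarrow>\<^sub>L real"
  have "L2_sums M (\<lambda>k \<omega>. (e k \<bullet> (a *\<^sub>R riesz f + b *\<^sub>R riesz g)) * y k \<omega>)
      (\<lambda>\<omega>. a * L2_series M y e (riesz f) \<omega> + b * L2_series M y e (riesz g) \<omega>)"
    using L2_sums_combination[OF L2_sums_L2_series[OF y e, of "riesz f"] L2_sums_L2_series[OF y e, of "riesz g"], of a b]
    by (simp add: inner_add_right algebra_simps)
  from L2_sums_unique[OF L2_sums_L2_series[OF y e] this]
  show "AE \<omega> in M. L2_series M y e (riesz (a *\<^sub>R f + b *\<^sub>R g)) \<omega> =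
      a * L2_series M y e (riesz f) \<omega> + b * L2_series M y e (riesz g) \<omega>"
    by (simp add: riesz_combination[OF e])
qed

lemma cylindrical_prob_L2_series:
  fixes e :: "nat \<Rightarrow> 'h::{real_inner,banach,second_countable_topology}"
  assumes y: "bessel_sequence M y" and e: "orthonormal_basis e"
  shows "cylindrical_prob (cyl_distr M (\<lambda>f. L2_series M y e (riesz f)))"
proof (rule cylindrical_prob_cyl_distr[OF prob_space_axioms linear_process_L2_series[OF y e]])
  fix f :: "'h \<Rightarrow>\<^sub>L real"
  show "integrable M (\<lambda>\<omega>. (L2_series M y e (riesz f) \<omega>)\<^sup>2)"
    using square_integrable_L2_series[OF y e] by (simp add: square_integrable_def)
  show "(\<integral>\<omega>. (L2_series M y e (riesz f) \<omega>)\<^sup>2 \<partial>M) \<le> (norm f)\<^sup>2"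
    using L2_series_square_le[OF y e, of "riesz f"] by (simp add: norm_riesz[OF e])
qed

end

section \<open>Convolution roots on the space of sequences\<close>

text \<open>
  Membership in a set of the sigma-algebra generated by \<open>\<Gamma>\<close> depends only on the values of the
  functionals in \<open>\<Gamma>\<close>, so their agreement on \<open>V\<close> and \<open>W\<close> is enough.
\<close>

lemma distr_cyl_sigma_cong_AE:
  fixes \<Gamma> :: "('v::real_normed_vector \<Rightarrow>\<^sub>L real) set"
  assumes \<Gamma>: "finite \<Gamma>"
    and V [measurable]: "V \<in> measurable M (cyl_sigma \<Gamma>)" and W [measurable]: "W \<in> measurable M (cyl_sigma \<Gamma>)"
    and ae: "AE \<omega> in M. \<forall>f\<in>\<Gamma>. f (V \<omega>) = f (W \<omega>)"
  shows "distr M (cyl_sigma \<Gamma>) V = distr M (cyl_sigma \<Gamma>) W"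
proof (rule measure_eqI)
  fix A assume A: "A \<in> sets (distr M (cyl_sigma \<Gamma>) V)"
  then have "A \<in> sigma_sets UNIV (cyl_generator \<Gamma>)" by simp
  then obtain n f B where f: "f ` {..<n} = \<Gamma>" and A_eq: "A = cyl_set n f B"
    by (rule sigma_sets_cyl_generator[OF \<Gamma>])
  have "emeasure M (V -` A \<inter> space M) = emeasure M (W -` A \<inter> space M)"
  proof (rule emeasure_eq_AE)
    show "AE \<omega> in M. (\<omega> \<in> V -` A \<inter> space M) = (\<omega> \<in> W -` A \<inter> space M)"
      using ae
    proof eventually_elim
      case (elim \<omega>)
      then have "(\<lambda>i\<in>{..<n}. f i (V \<omega>)) = (\<lambda>i\<in>{..<n}. f i (W \<omega>))"
        using f by (intro restrict_ext) auto
      then show ?case by (simp add: A_eq cyl_set_def)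
    qed
  qed (use A in \<open>auto intro!: measurable_sets[OF V] measurable_sets[OF W]\<close>)
  then show "emeasure (distr M (cyl_sigma \<Gamma>) V) A = emeasure (distr M (cyl_sigma \<Gamma>) W) A"
    using A by (simp add: emeasure_distr V W)
qed simp

lemma prob_space_cyl_restrict:
  assumes "cylindrical_prob \<eta>" "finite \<Gamma>"
  shows "prob_space (cyl_restrict \<eta> \<Gamma>)"
proof
  have "UNIV \<in> sigma_sets UNIV (cyl_generator \<Gamma>)" by (rule sigma_sets_top)
  then show "emeasure (cyl_restrict \<eta> \<Gamma>) (space (cyl_restrict \<eta> \<Gamma>)) = 1"
    using assms emeasure_cyl_restrict[of \<Gamma> \<eta> UNIV] by (simp add: cylindrical_prob_def)
qed

lemma measurable_functional_cyl_restrict: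
  "f \<in> \<Gamma> \<Longrightarrow> blinfun_apply f \<in> borel_measurable (cyl_restrict \<eta> \<Gamma>)"
  using measurable_functional_cyl_sigma[of f \<Gamma>]
  by (simp cong: measurable_cong_sets add: sets_cyl_restrict_cong)

lemma distr_PiM_iid:
  assumes N: "prob_space N" and f [measurable]: "f \<in> measurable N K" and I: "finite I"
  shows "distr (\<Pi>\<^sub>M i\<in>I. N) (\<Pi>\<^sub>M i\<in>I. K) (compose I f) = (\<Pi>\<^sub>M i\<in>I. distr N K f)"
proof -
  have "distr (\<Pi>\<^sub>M i\<in>I. N) (\<Pi>\<^sub>M i\<in>I. distr N K f) (compose I f) = (\<Pi>\<^sub>M i\<in>I. distr N (distr N K f) f)"
    by (intro distr_PiM_finite_prob_space' I N prob_space.prob_space_distr[OF N f]) simp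
  moreover have "distr N (distr N K f) f = distr N K f" by (rule distr_cong) simp_all
  moreover have "distr (\<Pi>\<^sub>M i\<in>I. N) (\<Pi>\<^sub>M i\<in>I. distr N K f) (compose I f) =
      distr (\<Pi>\<^sub>M i\<in>I. N) (\<Pi>\<^sub>M i\<in>I. K) (compose I f)"
    by (rule distr_cong) (simp_all cong: sets_PiM_cong)
  ultimately show ?thesis by simp
qed

lemma measurable_compose_PiM:
  "f \<in> measurable N K \<Longrightarrow> compose I f \<in> measurable (\<Pi>\<^sub>M i\<in>I. N) (\<Pi>\<^sub>M i\<in>I. K)"
  unfolding compose_def by (intro measurable_restrict measurable_compose[OF measurable_component_singleton])

text \<open>
  By Fubini's theorem, \<open>(s + F)\<^sup>2\<close> has finite integral under \<open>\<nu>\<close> for at least one value \<open>s\<close> of the sum of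
  the other summands, so \<open>F\<close> is square integrable.  The mean of \<open>F\<close> is zero, since \<open>k\<close> times it is
  zero; so in the square of the sum the mixed term vanishes, and what the other summands contribute is
  nonnegative.
\<close>

lemma iid_sum_square_bound:
  fixes k :: nat
  assumes \<nu>: "prob_space \<nu>" and F [measurable]: "F \<in> borel_measurable \<nu>" and k: "k \<ge> 1"
    and sq: "square_integrable (\<Pi>\<^sub>M i\<in>{..<k}. \<nu>) (\<lambda>x. \<Sum>i<k. F (x i))"
    and mean: "(\<integral>x. (\<Sum>i<k. F (x i)) \<partial>(\<Pi>\<^sub>M i\<in>{..<k}. \<nu>)) = 0"
  shows "square_integrable \<nu> F" "(\<integral>x. (F x)\<^sup>2 \<partial>\<nu>) \<le> (\<integral>x. (\<Sum>i<k. F (x i))\<^sup>2 \<partial>(\<Pi>\<^sub>M i\<in>{..<k}. \<nu>))"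
proof -
  interpret \<nu>: prob_space \<nu> by fact
  interpret product_prob_space "\<lambda>_. \<nu>" UNIV by unfold_locales
  from k obtain m where k_eq: "k = Suc m" by (cases k) auto
  let ?P = "\<lambda>n. \<Pi>\<^sub>M i\<in>{..<n::nat}. \<nu>"
  interpret Pm: prob_space "?P m" by (rule prob_space_PiM) (rule \<nu>)
  interpret Pk: prob_space "?P k" by (rule prob_space_PiM) (rule \<nu>)
  define s where "s x = (\<Sum>i<m. F (x i))" for x
  have insert: "{..<k} = insert m {..<m}" by (auto simp: k_eq)
  have sum_upd: "(\<Sum>i<k. F ((x(m := y)) i)) = s x + F y" for x y
    by (simp add: k_eq s_def)
  have meas [measurable]: "(\<lambda>x. \<Sum>i<k. F (x i)) \<in> borel_measurable (?P k)" by measurable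
  have meas_s [measurable]: "s \<in> borel_measurable (?P m)" unfolding s_def by measurable
  have "(\<integral>\<^sup>+x. ennreal ((\<Sum>i<k. F (x i))\<^sup>2) \<partial>?P k) =
      (\<integral>\<^sup>+x. (\<integral>\<^sup>+y. ennreal ((\<Sum>i<k. F ((x(m := y)) i))\<^sup>2) \<partial>\<nu>) \<partial>?P m)"
    unfolding insert by (subst product_nn_integral_insert) (auto simp: insert[symmetric])
  also have "\<dots> = (\<integral>\<^sup>+x. (\<integral>\<^sup>+y. ennreal ((s x + F y)\<^sup>2) \<partial>\<nu>) \<partial>?P m)"
    unfolding sum_upd ..
  finally have "(\<integral>\<^sup>+x. (\<integral>\<^sup>+y. ennreal ((s x + F y)\<^sup>2) \<partial>\<nu>) \<partial>?P m) \<noteq> \<infinity>"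
    using sq by (simp add: square_integrable_def integrable_iff_bounded)
  then have "AE x in ?P m. (\<integral>\<^sup>+y. ennreal ((s x + F y)\<^sup>2) \<partial>\<nu>) \<noteq> \<infinity>"
    by (intro nn_integral_PInf_AE) measurable
  then have "\<exists>x. (\<integral>\<^sup>+y. ennreal ((s x + F y)\<^sup>2) \<partial>\<nu>) \<noteq> \<infinity>"
    using eventually_happens' [OF Pm.ae_filter_bot] by blast
  then obtain x where "(\<integral>\<^sup>+y. ennreal ((s x + F y)\<^sup>2) \<partial>\<nu>) \<noteq> \<infinity>" by blast
  then have "square_integrable \<nu> (\<lambda>y. s x + F y)"
    by (auto simp: square_integrable_def top.not_eq_extremum intro!: integrableI_bounded)
  moreover have "square_integrable \<nu> (\<lambda>y. s x)" by (simp add: square_integrable_def)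
  ultimately show sqF: "square_integrable \<nu> F"
    using square_integrable_diff[of \<nu> "\<lambda>y. s x + F y" "\<lambda>y. s x"] by simp
  then have intF: "integrable \<nu> F"
    by (intro \<nu>.square_integral_abs_le(2)[OF F]) (simp add: square_integrable_def)
  have comp: "distr (?P n) \<nu> (\<lambda>x. x i) = \<nu>" if "i < n" for n i
    using that by (intro distr_PiM_component \<nu>) auto
  have mean_comp: "(\<integral>x. F (x i) \<partial>?P n) = (\<integral>x. F x \<partial>\<nu>)" if "i < n" for n i
    using integral_distr[of "\<lambda>x. x i" "?P n" \<nu> F] comp[OF that] that by simp
  have int_comp: "integrable (?P n) (\<lambda>x. F (x i))" if "i < n" for n i
    using integrable_distr_eq[of "\<lambda>x. x i" "?P n" \<nu> F] comp[OF that] that intF by simp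
  have sq_comp: "square_integrable (?P n) (\<lambda>x. F (x i))" if "i < n" for n i
    using integrable_distr_eq[of "\<lambda>x. x i" "?P n" \<nu> "\<lambda>x. (F x)\<^sup>2"] comp[OF that] that sqF
    by (simp add: square_integrable_def)
  have "real k * (\<integral>x. F x \<partial>\<nu>) = 0"
    using mean by (simp add: int_comp mean_comp)
  then have F0: "(\<integral>x. F x \<partial>\<nu>) = 0" using k by simp
  have sq_s: "square_integrable (?P m) s"
    unfolding s_def by (rule square_integrable_sum) (simp add: sq_comp)
  have inner: "(\<integral>y. (s x + F y)\<^sup>2 \<partial>\<nu>) = (s x)\<^sup>2 + (\<integral>y. (F y)\<^sup>2 \<partial>\<nu>)" for x
    using intF sqF by (simp add: power2_sum square_integrable_def F0 \<nu>.prob_space)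
  have "(\<integral>x. (\<Sum>i<k. F (x i))\<^sup>2 \<partial>?P k) = (\<integral>x. (\<integral>y. (\<Sum>i<k. F ((x(m := y)) i))\<^sup>2 \<partial>\<nu>) \<partial>?P m)"
    unfolding insert by (subst product_integral_insert)
      (use sq in \<open>auto simp: insert[symmetric] square_integrable_def\<close>)
  also have "\<dots> = (\<integral>x. (s x)\<^sup>2 + (\<integral>y. (F y)\<^sup>2 \<partial>\<nu>) \<partial>?P m)"
    unfolding sum_upd inner ..
  also have "\<dots> = (\<integral>x. (s x)\<^sup>2 \<partial>?P m) + (\<integral>y. (F y)\<^sup>2 \<partial>\<nu>)"
    using sq_s by (simp add: square_integrable_def Pm.prob_space)
  finally show "(\<integral>x. (F x)\<^sup>2 \<partial>\<nu>) \<le> (\<integral>x. (\<Sum>i<k. F (x i))\<^sup>2 \<partial>?P k)" by simp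
qed

abbreviation sequences :: "(nat \<Rightarrow> real) measure" where
  "sequences \<equiv> \<Pi>\<^sub>M k\<in>UNIV. borel"

text \<open>
  A cylindrical probability measure need not extend to a measure on \<open>'v\<close>, but its values on
  countably many functionals do have a joint law.
\<close>

lemma kolmogorov_sequence_law:
  fixes \<rho> :: "'v::real_normed_vector set \<Rightarrow> ennreal" and vs :: "nat \<Rightarrow> 'v \<Rightarrow>\<^sub>L real"
  assumes \<rho>: "cylindrical_prob \<rho>"
  obtains \<nu> where "prob_space \<nu>" "sets \<nu> = sets sequences"
    "\<And>J. finite J \<Longrightarrow> distr \<nu> (\<Pi>\<^sub>M k\<in>J. borel) (\<lambda>x. restrict x J) =
      distr (cyl_restrict \<rho> (vs ` J)) (\<Pi>\<^sub>M k\<in>J. borel) (\<lambda>v. \<lambda>k\<in>J. vs k v)"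
proof -
  let ?B = "\<lambda>J. \<Pi>\<^sub>M k\<in>J. (borel :: real measure)"
  let ?G = "\<lambda>J v. \<lambda>k\<in>J. blinfun_apply (vs k) v"
  define P where "P J = distr (cyl_restrict \<rho> (vs ` J)) (?B J) (?G J)" for J
  have G: "?G J \<in> measurable (cyl_restrict \<rho> (vs ` H)) (?B J)" if "J \<subseteq> H" for J H
    using that by (intro measurable_restrict measurable_functional_cyl_restrict) auto
  have ms: "measure_space UNIV (sigma_sets UNIV (cyl_generator (vs ` J))) \<rho>" if "finite J" for J
    using \<rho> that by (auto simp: cylindrical_prob_def)
  have em: "emeasure (cyl_restrict \<rho> (vs ` H)) (?G J -` B) = \<rho> (?G J -` B)"
    if "J \<subseteq> H" "finite H" "B \<in> sets (?B J)" for J H B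
    using measurable_sets[OF G[OF that(1)] that(3)] that(2)
    by (intro emeasure_cyl_restrict ms) (simp_all add: sets_cyl_restrict)
  interpret polish_projective UNIV P
  proof (intro polish_projective.intro projective_family.intro)
    fix J H :: "nat set" assume J: "J \<subseteq> H" "finite H"
    have "distr (P H) (?B J) (\<lambda>f. restrict f J) = distr (cyl_restrict \<rho> (vs ` H)) (?B J) (?G J)"
      unfolding P_def using J
      by (subst distr_distr[OF measurable_restrict_subset G]) (auto simp: comp_def Int_absorb1 intro!: distr_cong)
    also have "\<dots> = P J"
      unfolding P_def using J finite_subset[OF J]
      by (intro measure_eqI) (auto simp: emeasure_distr G em)
    finally show "P J = distr (P H) (?B J) (\<lambda>f. restrict f J)" ..
  next
    fix J :: "nat set" assume "finite J"
    then show "prob_space (P J)"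
      unfolding P_def by (intro prob_space.prob_space_distr prob_space_cyl_restrict \<rho> G) auto
  qed
  show thesis
  proof (rule that[of lim])
    show "prob_space lim" by (rule P.prob_space_axioms)
    show "sets lim = sets sequences" by simp
    fix J :: "nat set" assume J: "finite J"
    have "distr lim (?B J) (\<lambda>x. restrict x J) = P J"
    proof (rule measure_eqI)
      fix A assume A: "A \<in> sets (distr lim (?B J) (\<lambda>x. restrict x J))"
      have "(\<lambda>x. restrict x J) \<in> measurable lim (?B J)"
        using measurable_restrict_subset[of J UNIV] by (simp cong: measurable_cong_sets)
      then show "emeasure (distr lim (?B J) (\<lambda>x. restrict x J)) A = emeasure (P J) A"
        using A emeasure_lim_emb[of J A] J by (simp add: emeasure_distr prod_emb_def space_PiM)
    qed (simp add: P_def)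
    then show "distr lim (?B J) (\<lambda>x. restrict x J) = distr (cyl_restrict \<rho> (vs ` J)) (?B J) (?G J)"
      by (simp add: P_def)
  qed
qed

text \<open>
  Both laws are determined by their finite-dimensional marginals, and over a finite index set \<open>J\<close> the
  convolution identity applies to the sigma-algebra generated by the functionals \<open>vs l\<close>, \<open>l \<in> J\<close>.
\<close>

lemma distr_sequences_convolution_power:
  fixes X :: "('v::{real_normed_vector,second_countable_topology} \<Rightarrow>\<^sub>L real) \<Rightarrow> 'w \<Rightarrow> real"
  assumes M: "prob_space M" and X: "linear_process M X"
    and \<rho>: "cylindrical_prob \<rho>" and conv: "is_convolution_power \<rho> k (cyl_distr M X)"
    and \<nu>: "prob_space \<nu>" "sets \<nu> = sets sequences"
    and marg: "\<And>J. finite J \<Longrightarrow> distr \<nu> (\<Pi>\<^sub>M k\<in>J. borel) (\<lambda>x. restrict x J) =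
      distr (cyl_restrict \<rho> (vs ` J)) (\<Pi>\<^sub>M k\<in>J. borel) (\<lambda>v. \<lambda>k\<in>J. vs k v)"
  shows "distr M sequences (\<lambda>\<omega> l. X (vs l) \<omega>) =
    distr (\<Pi>\<^sub>M i\<in>{..<k}. \<nu>) sequences (\<lambda>x l. \<Sum>i<k. x i l)"
proof (rule measure_eqI_PiM_infinite)
  interpret M: prob_space M by fact
  note [measurable] = linear_process_measurable[OF X]
  note [measurable_cong] = \<nu>(2)
  have X_seq [measurable]: "(\<lambda>\<omega> l. X (vs l) \<omega>) \<in> measurable M sequences"
    by (rule measurable_abs_UNIV) measurable
  have sum_seq [measurable]: "(\<lambda>x l. \<Sum>i<k. x i l) \<in> measurable (\<Pi>\<^sub>M i\<in>{..<k}. \<nu>) sequences"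
  proof (rule measurable_abs_UNIV, rule borel_measurable_sum)
    fix l i assume "i \<in> {..<k}"
    then have "(\<lambda>x. x i) \<in> measurable (\<Pi>\<^sub>M i\<in>{..<k}. \<nu>) \<nu>" by (rule measurable_component_singleton)
    moreover have "(\<lambda>z. z l) \<in> borel_measurable \<nu>" by measurable
    ultimately show "(\<lambda>x. x i l) \<in> borel_measurable (\<Pi>\<^sub>M i\<in>{..<k}. \<nu>)" by (rule measurable_compose)
  qed
  show "finite_measure (distr M sequences (\<lambda>\<omega> l. X (vs l) \<omega>))"
    by (intro prob_space.finite_measure M.prob_space_distr X_seq)
  fix A :: "nat \<Rightarrow> real set" and J :: "nat set"
  assume J: "finite J" and "\<And>l. l \<in> J \<Longrightarrow> A l \<in> sets borel"
  then have A [measurable]: "\<And>l. l \<in> J \<Longrightarrow> A l \<in> sets borel" by simp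
  let ?B = "\<Pi>\<^sub>M l\<in>J. (borel :: real measure)" and ?\<Gamma> = "vs ` J"
  let ?G = "\<lambda>v. \<lambda>l\<in>J. blinfun_apply (vs l) v"
  let ?R = "cyl_restrict \<rho> ?\<Gamma>"
  let ?C = "{v. \<forall>l\<in>J. blinfun_apply (vs l) v \<in> A l}"
  let ?D = "{z \<in> space (\<Pi>\<^sub>M i\<in>{..<k}. ?B). \<forall>l\<in>J. (\<Sum>i<k. z i l) \<in> A l}"
  have \<Gamma>: "finite ?\<Gamma>" using J by simp
  have R: "prob_space ?R" by (rule prob_space_cyl_restrict[OF \<rho> \<Gamma>])
  have G: "?G \<in> measurable ?R ?B"
    by (intro measurable_restrict measurable_functional_cyl_restrict) auto
  have restr: "(\<lambda>x. restrict x J) \<in> measurable \<nu> ?B"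
    using measurable_restrict_subset[of J UNIV] by (simp cong: measurable_cong_sets)
  have C: "?C \<in> sets (cyl_sigma ?\<Gamma>)"
  proof -
    have "{v \<in> space (cyl_sigma ?\<Gamma>). \<forall>l\<in>J. blinfun_apply (vs l) v \<in> A l} \<in> sets (cyl_sigma ?\<Gamma>)"
      using J by (intro sets.sets_Collect_finite_All
          measurable_sets_Collect[OF measurable_functional_cyl_sigma]) auto
    then show ?thesis by (simp add: space_measure_of_conv)
  qed
  have D: "?D \<in> sets (\<Pi>\<^sub>M i\<in>{..<k}. ?B)"
  proof -
    have [measurable]: "(\<lambda>z. \<Sum>i<k. z i l) \<in> borel_measurable (\<Pi>\<^sub>M i\<in>{..<k}. ?B)" if "l \<in> J" for l
    proof (rule borel_measurable_sum)
      fix i assume "i \<in> {..<k}"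
      with that show "(\<lambda>z. z i l) \<in> borel_measurable (\<Pi>\<^sub>M i\<in>{..<k}. ?B)"
        by (intro measurable_compose[of "\<lambda>z. z i" _ ?B "\<lambda>w. w l"] measurable_component_singleton)
    qed
    show ?thesis using J by measurable
  qed
  obtain V where V [measurable]: "V \<in> borel_measurable M"
    and ae: "AE \<omega> in M. \<forall>f\<in>?\<Gamma>. X f \<omega> = f (V \<omega>)"
    by (rule linear_process_realization[OF X \<Gamma>])
  have V': "V \<in> measurable M (cyl_sigma ?\<Gamma>)"
    by (rule measurable_into_cyl_sigma) measurable
  have sum_R: "(\<lambda>x. \<Sum>i<k. x i) \<in> measurable (\<Pi>\<^sub>M i\<in>{..<k}. ?R) (cyl_sigma ?\<Gamma>)"
  proof (rule measurable_into_cyl_sigma)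
    fix f assume "f \<in> ?\<Gamma>"
    note [measurable] = measurable_functional_cyl_restrict[OF this, of \<rho>]
    show "(\<lambda>x. f (\<Sum>i<k. x i)) \<in> borel_measurable (\<Pi>\<^sub>M i\<in>{..<k}. ?R)"
      unfolding blinfun.sum_right by measurable
  qed
  have emb: "prod_emb UNIV (\<lambda>_. borel) J (Pi\<^sub>E J A) = {z. \<forall>l\<in>J. z l \<in> A l}"
    by (auto simp: prod_emb_def)
  have emb_sets: "prod_emb UNIV (\<lambda>_. borel) J (Pi\<^sub>E J A) \<in> sets sequences"
    using J by (intro sets_PiM_I) auto
  have "emeasure (distr M sequences (\<lambda>\<omega> l. X (vs l) \<omega>)) (prod_emb UNIV (\<lambda>_. borel) J (Pi\<^sub>E J A)) =
      emeasure M {\<omega> \<in> space M. \<forall>l\<in>J. X (vs l) \<omega> \<in> A l}"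
    unfolding emeasure_distr[OF X_seq emb_sets]
    by (rule arg_cong[where f = "emeasure M"]) (auto simp: emb)
  also have "\<dots> = emeasure M {\<omega> \<in> space M. \<forall>l\<in>J. vs l (V \<omega>) \<in> A l}"
    using J by (intro emeasure_eq_AE) (use ae in \<open>auto elim!: eventually_mono\<close>)
  also have "\<dots> = emeasure (distr M (cyl_sigma ?\<Gamma>) V) ?C"
    unfolding emeasure_distr[OF V' C] by (rule arg_cong[where f = "emeasure M"]) auto
  also have "\<dots> = emeasure (cyl_restrict (cyl_distr M X) ?\<Gamma>) ?C"
    unfolding cyl_restrict_cyl_distr[OF X V ae \<Gamma>] ..
  also have "\<dots> = emeasure (distr (\<Pi>\<^sub>M i\<in>{..<k}. ?R) (cyl_sigma ?\<Gamma>) (\<lambda>x. \<Sum>i<k. x i)) ?C"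
  proof -
    have "cyl_restrict (cyl_distr M X) ?\<Gamma> =
        distr (\<Pi>\<^sub>M i\<in>{..<k}. ?R) (cyl_restrict (cyl_distr M X) ?\<Gamma>) (\<lambda>x. \<Sum>i<k. x i)"
      using conv \<Gamma> unfolding is_convolution_power_def by blast
    also have "\<dots> = distr (\<Pi>\<^sub>M i\<in>{..<k}. ?R) (cyl_sigma ?\<Gamma>) (\<lambda>x. \<Sum>i<k. x i)"
      by (rule distr_cong) (simp_all add: sets_cyl_restrict)
    finally show ?thesis by simp
  qed
  also have "\<dots> = emeasure (distr (\<Pi>\<^sub>M i\<in>{..<k}. ?R) (\<Pi>\<^sub>M i\<in>{..<k}. ?B) (compose {..<k} ?G)) ?D"
    unfolding emeasure_distr[OF sum_R C] emeasure_distr[OF measurable_compose_PiM[OF G] D]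
    by (rule arg_cong[where f = "emeasure (\<Pi>\<^sub>M i\<in>{..<k}. ?R)"])
      (auto simp: compose_def blinfun.sum_right space_PiM)
  also have "\<dots> = emeasure (distr (\<Pi>\<^sub>M i\<in>{..<k}. \<nu>) (\<Pi>\<^sub>M i\<in>{..<k}. ?B) (compose {..<k} (\<lambda>x. restrict x J))) ?D"
    unfolding distr_PiM_iid[OF R G finite_lessThan] distr_PiM_iid[OF \<nu>(1) restr finite_lessThan]
      marg[OF J] ..
  also have "\<dots> = emeasure (distr (\<Pi>\<^sub>M i\<in>{..<k}. \<nu>) sequences (\<lambda>x l. \<Sum>i<k. x i l))
      (prod_emb UNIV (\<lambda>_. borel) J (Pi\<^sub>E J A))"
    unfolding emeasure_distr[OF measurable_compose_PiM[OF restr] D] emeasure_distr[OF sum_seq emb_sets]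
    by (rule arg_cong[where f = "emeasure (\<Pi>\<^sub>M i\<in>{..<k}. \<nu>)"])
      (auto simp: compose_def emb space_PiM)
  finally show "emeasure (distr M sequences (\<lambda>\<omega> l. X (vs l) \<omega>)) (prod_emb UNIV (\<lambda>_. borel) J (Pi\<^sub>E J A)) =
    emeasure (distr (\<Pi>\<^sub>M i\<in>{..<k}. \<nu>) sequences (\<lambda>x l. \<Sum>i<k. x i l)) (prod_emb UNIV (\<lambda>_. borel) J (Pi\<^sub>E J A))" .
qed simp_all

lemma measurable_PiM_component_sequences:
  assumes "sets \<nu> = sets sequences" "i \<in> I"
  shows "(\<lambda>x. x i l) \<in> borel_measurable (\<Pi>\<^sub>M i\<in>I. \<nu>)"
proof (rule measurable_compose[where f = "\<lambda>x. x i" and g = "\<lambda>z. z l"])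
  show "(\<lambda>x. x i) \<in> measurable (\<Pi>\<^sub>M i\<in>I. \<nu>) \<nu>" by (rule measurable_component_singleton[OF assms(2)])
  show "(\<lambda>z. z l) \<in> borel_measurable \<nu>" using assms(1) by (simp cong: measurable_cong_sets)
qed

lemma measurable_PiM_sum_sequences:
  assumes "sets \<nu> = sets sequences"
  shows "(\<lambda>x l. \<Sum>i<k. x i l) \<in> measurable (\<Pi>\<^sub>M i\<in>{..<k::nat}. \<nu>) sequences"
  by (intro measurable_abs_UNIV borel_measurable_sum measurable_PiM_component_sequences assms)

text \<open>
  A finite linear combination \<open>F\<close> of coordinates is additive, so its value at the sum of the
  independent sequences is a sum of independent copies, to which \<open>iid_sum_square_bound\<close> applies.
\<close>

lemma bessel_sequence_convolution_root:
  fixes k :: nat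
  assumes M: "prob_space M" and y: "bessel_sequence M y" and mean: "\<And>l. (\<integral>\<omega>. y l \<omega> \<partial>M) = 0"
    and \<nu>: "prob_space \<nu>" "sets \<nu> = sets sequences" and k: "k \<ge> 1"
    and law: "distr M sequences (\<lambda>\<omega> l. y l \<omega>) = distr (\<Pi>\<^sub>M i\<in>{..<k}. \<nu>) sequences (\<lambda>x l. \<Sum>i<k. x i l)"
  shows "bessel_sequence \<nu> (\<lambda>l x. x l)"
proof -
  interpret M: prob_space M by fact
  have sq_y: "square_integrable M (y l)" for l using y by (simp add: bessel_sequence_def)
  have [measurable]: "y l \<in> borel_measurable M" for l using sq_y by (simp add: square_integrable_def)
  have int_y: "integrable M (y l)" for l
    using sq_y[of l] by (intro M.square_integral_abs_le(2)[of "y l"]) (simp_all add: square_integrable_def)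
  have y_seq: "(\<lambda>\<omega> l. y l \<omega>) \<in> measurable M sequences"
    by (rule measurable_abs_UNIV) measurable
  note sum_seq = measurable_PiM_sum_sequences[OF \<nu>(2), of k]
  define F where "F c n z = (\<Sum>l<n. c l * z l)" for c :: "nat \<Rightarrow> real" and n :: nat and z :: "nat \<Rightarrow> real"
  have F_meas [measurable]: "F c n \<in> borel_measurable sequences" for c n
    unfolding F_def by measurable
  then have F_\<nu>: "F c n \<in> borel_measurable \<nu>" for c n
    using \<nu>(2) by (simp cong: measurable_cong_sets)
  have F_sum: "F c n (\<lambda>l. \<Sum>i<k. x i l) = (\<Sum>i<k. F c n (x i))" for c n x
    unfolding F_def by (subst sum.swap) (simp add: sum_distrib_left)
  have transfer: "integrable M (\<lambda>\<omega>. H (\<lambda>l. y l \<omega>)) \<longleftrightarrow>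
        integrable (\<Pi>\<^sub>M i\<in>{..<k}. \<nu>) (\<lambda>x. H (\<lambda>l. \<Sum>i<k. x i l))"
      "(\<integral>\<omega>. H (\<lambda>l. y l \<omega>) \<partial>M) = (\<integral>x. H (\<lambda>l. \<Sum>i<k. x i l) \<partial>(\<Pi>\<^sub>M i\<in>{..<k}. \<nu>))"
    if "H \<in> borel_measurable sequences" for H :: "(nat \<Rightarrow> real) \<Rightarrow> real"
    using integrable_distr_eq[OF y_seq that] integrable_distr_eq[OF sum_seq that]
      integral_distr[OF y_seq that] integral_distr[OF sum_seq that] unfolding law by auto
  have F_M: "square_integrable M (\<lambda>\<omega>. F c n (\<lambda>l. y l \<omega>))" for c n
    unfolding F_def by (intro square_integrable_sum square_integrable_scale sq_y)
  have sq_sum: "square_integrable (\<Pi>\<^sub>M i\<in>{..<k}. \<nu>) (\<lambda>x. \<Sum>i<k. F c n (x i))" for c n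
  proof -
    have "(\<lambda>x. F c n (\<lambda>l. \<Sum>i<k. x i l)) \<in> borel_measurable (\<Pi>\<^sub>M i\<in>{..<k}. \<nu>)"
      by (rule measurable_compose[OF sum_seq F_meas])
    then show ?thesis
      using F_M[of c n] transfer(1)[of "\<lambda>z. (F c n z)\<^sup>2"] by (simp add: square_integrable_def F_sum)
  qed
  have "(\<integral>\<omega>. F c n (\<lambda>l. y l \<omega>) \<partial>M) = 0" for c n
    unfolding F_def by (simp add: int_y mean)
  then have mean_sum: "(\<integral>x. (\<Sum>i<k. F c n (x i)) \<partial>(\<Pi>\<^sub>M i\<in>{..<k}. \<nu>)) = 0" for c n
    using transfer(2)[of "F c n"] by (simp add: F_sum)
  note bound = iid_sum_square_bound[OF \<nu>(1) F_\<nu> k sq_sum mean_sum]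
  show ?thesis
    unfolding bessel_sequence_def
  proof (intro conjI allI)
    fix l
    have "F (\<lambda>i. if i = l then 1 else 0) (Suc l) = (\<lambda>z. z l)"
      by (rule ext) (simp add: F_def if_distrib cong: if_cong)
    then show "square_integrable \<nu> (\<lambda>x. x l)"
      using bound(1)[of "\<lambda>i. if i = l then 1 else 0" "Suc l"] by simp
  next
    fix c n
    have "(\<integral>x. (F c n x)\<^sup>2 \<partial>\<nu>) \<le> (\<integral>x. (\<Sum>i<k. F c n (x i))\<^sup>2 \<partial>(\<Pi>\<^sub>M i\<in>{..<k}. \<nu>))"
      by (rule bound(2))
    also have "\<dots> = (\<integral>\<omega>. (F c n (\<lambda>l. y l \<omega>))\<^sup>2 \<partial>M)"
      using transfer(2)[of "\<lambda>z. (F c n z)\<^sup>2"] by (simp add: F_sum)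
    also have "\<dots> \<le> (\<Sum>l<n. (c l)\<^sup>2)"
      using y by (simp add: F_def bessel_sequence_def)
    finally show "(\<integral>x. (\<Sum>l<n. c l * x l)\<^sup>2 \<partial>\<nu>) \<le> (\<Sum>l<n. (c l)\<^sup>2)" by (simp add: F_def)
  qed
qed

text \<open>
  The comparison runs through the common law \<open>L\<close> of \<open>y\<close> and of the sum of \<open>k\<close> independent sequences.
  Let \<open>S\<close> be the series of the coordinates under \<open>L\<close>.  Pulled back along \<open>y\<close> it is the series of \<open>y\<close>;
  pulled back along the summation map it is, by uniqueness of \<open>L\<^sup>2\<close> limits, the sum of the series of
  the \<open>k\<close> summands.
\<close>

lemma is_convolution_power_L2_series:
  fixes e :: "nat \<Rightarrow> 'h::{real_inner,banach,second_countable_topology}"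
  assumes M: "prob_space M" and y: "bessel_sequence M y" and e: "orthonormal_basis e"
    and \<nu>: "prob_space \<nu>" "sets \<nu> = sets sequences" and bessel_\<nu>: "bessel_sequence \<nu> (\<lambda>l x. x l)"
    and law: "distr M sequences (\<lambda>\<omega> l. y l \<omega>) = distr (\<Pi>\<^sub>M i\<in>{..<k}. \<nu>) sequences (\<lambda>x l. \<Sum>i<k. x i l)"
  shows "is_convolution_power (cyl_distr \<nu> (\<lambda>f. L2_series \<nu> (\<lambda>l x. x l) e (riesz f))) k
    (cyl_distr M (\<lambda>f. L2_series M y e (riesz f)))"
  unfolding is_convolution_power_def
proof (intro allI impI)
  fix \<Gamma> :: "('h \<Rightarrow>\<^sub>L real) set" assume \<Gamma>: "finite \<Gamma>"
  interpret M: prob_space M by fact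
  interpret \<nu>: prob_space \<nu> by fact
  let ?P = "\<Pi>\<^sub>M i\<in>{..<k}. \<nu>"
  let ?y = "\<lambda>\<omega> l. y l \<omega>" and ?sum = "\<lambda>x l. \<Sum>i<k. x i l :: real"
  define L where "L = distr M sequences ?y"
  have [measurable]: "y l \<in> borel_measurable M" for l
    using y by (simp add: bessel_sequence_def square_integrable_def)
  have y_seq [measurable]: "?y \<in> measurable M sequences"
    by (rule measurable_abs_UNIV) measurable
  note sum_seq [measurable] = measurable_PiM_sum_sequences[OF \<nu>(2), of k]
  have L_sum: "L = distr ?P sequences ?sum" by (simp add: L_def law)
  have L: "prob_space L" unfolding L_def by (rule M.prob_space_distr[OF y_seq])
  interpret L: prob_space L by fact
  have bessel_L: "bessel_sequence L (\<lambda>l x. x l)"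
    using y unfolding bessel_sequence_def square_integrable_def L_def
    by (simp add: integrable_distr_eq[OF y_seq] integral_distr[OF y_seq])
  define S where "S f = L2_series L (\<lambda>l x. x l) e (riesz f)" for f
  define T where "T f = L2_series \<nu> (\<lambda>l x. x l) e (riesz f)" for f
  define U where "U f = L2_series M y e (riesz f)" for f
  have S_lin: "linear_process L S" unfolding S_def[abs_def] by (rule L.linear_process_L2_series[OF bessel_L e])
  have T_lin: "linear_process \<nu> T" unfolding T_def[abs_def] by (rule \<nu>.linear_process_L2_series[OF bessel_\<nu> e])
  have U_lin: "linear_process M U" unfolding U_def[abs_def] by (rule M.linear_process_L2_series[OF y e])
  have S_sums: "L2_sums L (\<lambda>l x. (e l \<bullet> riesz f) * x l) (S f)" for f
    unfolding S_def by (rule L.L2_sums_L2_series[OF bessel_L e])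
  have U_S: "AE \<omega> in M. U f \<omega> = S f (?y \<omega>)" for f
    using L2_sums_distr[OF y_seq S_sums[of f, unfolded L_def]]
      M.L2_sums_L2_series[OF y e, of "riesz f"]
    by (intro L2_sums_unique) (auto simp: U_def)
  have T_S: "AE x in ?P. (\<Sum>i<k. T f (x i)) = S f (?sum x)" for f
  proof (rule L2_sums_unique)
    show "L2_sums ?P (\<lambda>l x. (e l \<bullet> riesz f) * ?sum x l) (\<lambda>x. S f (?sum x))"
      using S_sums[of f] unfolding L_sum by (rule L2_sums_distr[OF sum_seq])
    have "L2_sums ?P (\<lambda>l x. (e l \<bullet> riesz f) * x i l) (\<lambda>x. T f (x i))" if "i < k" for i
    proof (rule L2_sums_distr[where \<phi> = "\<lambda>x. x i" and N = \<nu>])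
      have "distr ?P \<nu> (\<lambda>x. x i) = \<nu>"
        using that by (intro distr_PiM_component \<nu>) auto
      then show "L2_sums (distr ?P \<nu> (\<lambda>x. x i)) (\<lambda>l x. (e l \<bullet> riesz f) * x l) (T f)"
        unfolding T_def by (simp add: \<nu>.L2_sums_L2_series[OF bessel_\<nu> e])
    qed (use that in simp)
    then show "L2_sums ?P (\<lambda>l x. (e l \<bullet> riesz f) * ?sum x l) (\<lambda>x. \<Sum>i<k. T f (x i))"
      unfolding sum_distrib_left by (rule L2_sums_sum)
  qed
  obtain W where W [measurable]: "W \<in> borel_measurable L" and W_ae: "AE x in L. \<forall>f\<in>\<Gamma>. S f x = f (W x)"
    by (rule linear_process_realization[OF S_lin \<Gamma>])
  obtain V where V [measurable]: "V \<in> borel_measurable \<nu>" and V_ae: "AE x in \<nu>. \<forall>f\<in>\<Gamma>. T f x = f (V x)"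
    by (rule linear_process_realization[OF T_lin \<Gamma>])
  have W_seq: "W \<in> borel_measurable sequences" using W unfolding L_def by simp
  have W' [measurable]: "W \<in> measurable sequences (cyl_sigma \<Gamma>)"
    by (rule measurable_into_cyl_sigma) (use W_seq in measurable)
  have V' [measurable]: "V \<in> measurable \<nu> (cyl_sigma \<Gamma>)"
    by (rule measurable_into_cyl_sigma) measurable
  \<comment> \<open>One vector \<open>W\<close> that realizes \<open>S\<close> under \<open>L\<close> serves both on \<open>M\<close> and on the product space.\<close>
  have "AE \<omega> in M. \<forall>f\<in>\<Gamma>. U f \<omega> = f (W (?y \<omega>))"
  proof -
    have "AE \<omega> in M. \<forall>f\<in>\<Gamma>. S f (?y \<omega>) = f (W (?y \<omega>))"
      using W_ae unfolding L_def by (rule AE_distrD[OF y_seq])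
    moreover have "AE \<omega> in M. \<forall>f\<in>\<Gamma>. U f \<omega> = S f (?y \<omega>)"
      using \<Gamma> U_S by (simp add: AE_ball_countable countable_finite)
    ultimately show ?thesis by eventually_elim simp
  qed
  with measurable_compose[OF y_seq W_seq]
  have restrict_U: "cyl_restrict (cyl_distr M U) \<Gamma> = distr M (cyl_sigma \<Gamma>) (\<lambda>\<omega>. W (?y \<omega>))"
    by (intro cyl_restrict_cyl_distr[OF U_lin _ _ \<Gamma>])
  also have "\<dots> = distr L (cyl_sigma \<Gamma>) W"
    unfolding L_def by (simp add: distr_distr[OF W' y_seq] comp_def)
  also have "\<dots> = distr ?P (cyl_sigma \<Gamma>) (\<lambda>x. W (?sum x))"
    unfolding L_sum by (simp add: distr_distr[OF W' sum_seq] comp_def)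
  also have "\<dots> = distr ?P (cyl_sigma \<Gamma>) (\<lambda>x. \<Sum>i<k. V (x i))"
  proof (rule distr_cyl_sigma_cong_AE[OF \<Gamma>])
    show "(\<lambda>x. W (?sum x)) \<in> measurable ?P (cyl_sigma \<Gamma>)" by measurable
    show "(\<lambda>x. \<Sum>i<k. V (x i)) \<in> measurable ?P (cyl_sigma \<Gamma>)"
      by (rule measurable_into_cyl_sigma) measurable
    have 1: "AE x in ?P. \<forall>f\<in>\<Gamma>. S f (?sum x) = f (W (?sum x))"
      using W_ae unfolding L_sum by (rule AE_distrD[OF sum_seq])
    have 2: "AE x in ?P. \<forall>f\<in>\<Gamma>. (\<Sum>i<k. T f (x i)) = S f (?sum x)"
      using \<Gamma> T_S by (simp add: AE_ball_countable countable_finite)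
    have "AE x in ?P. \<forall>f\<in>\<Gamma>. T f (x i) = f (V (x i))" if "i < k" for i
      using AE_PiM_component[of "{..<k}" "\<lambda>_. \<nu>" i "\<lambda>z. \<forall>f\<in>\<Gamma>. T f z = f (V z)"] \<nu>(1) V_ae that
      by simp
    then have "AE x in ?P. \<forall>i\<in>{..<k}. \<forall>f\<in>\<Gamma>. T f (x i) = f (V (x i))"
      by (simp add: AE_ball_countable countable_finite)
    with 1 2 show "AE x in ?P. \<forall>f\<in>\<Gamma>. f (W (?sum x)) = f (\<Sum>i<k. V (x i))"
      by eventually_elim (simp add: blinfun.sum_right)
  qed
  also have "\<dots> = distr (distr ?P (\<Pi>\<^sub>M i\<in>{..<k}. cyl_sigma \<Gamma>) (compose {..<k} V)) (cyl_sigma \<Gamma>) (\<lambda>x. \<Sum>i<k. x i)"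
  proof (subst distr_distr)
    show "(\<lambda>x. \<Sum>i<k. x i) \<in> measurable (\<Pi>\<^sub>M i\<in>{..<k}. cyl_sigma \<Gamma>) (cyl_sigma \<Gamma>)"
    proof (rule measurable_into_cyl_sigma)
      fix f assume "f \<in> \<Gamma>"
      note [measurable] = measurable_functional_cyl_sigma[OF this]
      show "(\<lambda>x. f (\<Sum>i<k. x i)) \<in> borel_measurable (\<Pi>\<^sub>M i\<in>{..<k}. cyl_sigma \<Gamma>)"
        unfolding blinfun.sum_right by measurable
    qed
    show "compose {..<k} V \<in> measurable ?P (\<Pi>\<^sub>M i\<in>{..<k}. cyl_sigma \<Gamma>)"
      by (rule measurable_compose_PiM[OF V'])
    show "distr ?P (cyl_sigma \<Gamma>) (\<lambda>x. \<Sum>i<k. V (x i)) =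
        distr ?P (cyl_sigma \<Gamma>) ((\<lambda>x. \<Sum>i<k. x i) \<circ> compose {..<k} V)"
      by (simp add: comp_def compose_def)
  qed
  also have "\<dots> = distr (\<Pi>\<^sub>M i\<in>{..<k}. cyl_restrict (cyl_distr \<nu> T) \<Gamma>) (cyl_sigma \<Gamma>) (\<lambda>x. \<Sum>i<k. x i)"
    unfolding distr_PiM_iid[OF \<nu>(1) V' finite_lessThan] cyl_restrict_cyl_distr[OF T_lin V V_ae \<Gamma>] ..
  also have "\<dots> = distr (\<Pi>\<^sub>M i\<in>{..<k}. cyl_restrict (cyl_distr \<nu> T) \<Gamma>) (cyl_restrict (cyl_distr M U) \<Gamma>) (\<lambda>x. \<Sum>i<k. x i)"
    by (rule distr_cong) (simp_all add: sets_cyl_restrict)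
  finally show "cyl_restrict (cyl_distr M (\<lambda>f. L2_series M y e (riesz f))) \<Gamma> =
    distr (\<Pi>\<^sub>M i\<in>{..<k}. cyl_restrict (cyl_distr \<nu> (\<lambda>f. L2_series \<nu> (\<lambda>l x. x l) e (riesz f))) \<Gamma>)
      (cyl_restrict (cyl_distr M (\<lambda>f. L2_series M y e (riesz f))) \<Gamma>) (\<lambda>x. \<Sum>i<k. x i)"
    unfolding T_def[abs_def] U_def[abs_def] .
qed

section \<open>Infinite divisibility, cotype and the factorization through the Hilbert space\<close>

text \<open>
  The root of order \<open>k\<close> is the distribution of the same series, formed with the coordinates of the
  Kolmogorov law of a root of the distribution of \<open>X\<close>.
\<close>

lemma cyl_infinitely_divisible_L2_series:
  fixes X :: "('v::{real_normed_vector,second_countable_topology} \<Rightarrow>\<^sub>L real) \<Rightarrow> 'w \<Rightarrow> real"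
    and e :: "nat \<Rightarrow> 'h::{real_inner,banach,second_countable_topology}"
  assumes M: "prob_space M" and X: "linear_process M X"
    and div: "cyl_infinitely_divisible (cyl_distr M X)"
    and bessel: "bessel_sequence M (\<lambda>k. X (vs k))" and mean: "\<And>k. (\<integral>\<omega>. X (vs k) \<omega> \<partial>M) = 0"
    and e: "orthonormal_basis e"
  shows "cyl_infinitely_divisible (cyl_distr M (\<lambda>f. L2_series M (\<lambda>k. X (vs k)) e (riesz f)))"
  unfolding cyl_infinitely_divisible_def
proof (intro conjI allI impI)
  show "cylindrical_prob (cyl_distr M (\<lambda>f. L2_series M (\<lambda>k. X (vs k)) e (riesz f)))"
    by (rule prob_space.cylindrical_prob_L2_series[OF M bessel e])
  fix k :: nat assume k: "k \<ge> 1"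
  with div obtain \<rho> where \<rho>: "cylindrical_prob \<rho>" "is_convolution_power \<rho> k (cyl_distr M X)"
    by (auto simp: cyl_infinitely_divisible_def)
  obtain \<nu> where \<nu>: "prob_space \<nu>" "sets \<nu> = sets sequences"
    "\<And>J. finite J \<Longrightarrow> distr \<nu> (\<Pi>\<^sub>M k\<in>J. borel) (\<lambda>x. restrict x J) =
      distr (cyl_restrict \<rho> (vs ` J)) (\<Pi>\<^sub>M k\<in>J. borel) (\<lambda>v. \<lambda>k\<in>J. vs k v)"
    by (rule kolmogorov_sequence_law[OF \<rho>(1), of vs]) blast
  note law = distr_sequences_convolution_power[OF M X \<rho> \<nu>]
  note bessel_\<nu> = bessel_sequence_convolution_root[OF M bessel mean \<nu>(1,2) k law]
  show "\<exists>\<rho>. cylindrical_prob \<rho> \<and>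
      is_convolution_power \<rho> k (cyl_distr M (\<lambda>f. L2_series M (\<lambda>k. X (vs k)) e (riesz f)))"
    using prob_space.cylindrical_prob_L2_series[OF \<nu>(1) bessel_\<nu> e]
      is_convolution_power_L2_series[OF M bessel e \<nu>(1,2) bessel_\<nu> law] by blast
qed

lemma Theta_eq_L2_series: "Theta M X e vs = L2_series M (\<lambda>k. X (vs k)) e"
  by (rule ext) (simp add: Theta_def L2_series_def)

theorem lemma3p1:
  fixes M :: "'w measure"
    and X :: "('v::{banach,second_countable_topology} \<Rightarrow>\<^sub>L real) \<Rightarrow> 'w \<Rightarrow> real"
    and Q :: "('v \<Rightarrow>\<^sub>L real) \<Rightarrow> 'v"
    and j :: "'h::{real_inner,banach,second_countable_topology} \<Rightarrow>\<^sub>L 'v"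
    and e :: "nat \<Rightarrow> 'h"
    and vs :: "nat \<Rightarrow> ('v \<Rightarrow>\<^sub>L real)"
  assumes "prob_space M"
    and "cylindrical_rv M X"
    and "cyl_infinitely_divisible (cyl_distr M X)"
    and "\<And>f. square_integrable M (X f)"
    and "\<And>f. (\<integral>\<omega>. X f \<omega> \<partial>M) = 0"
    and "covariance_operator M X Q"
    and "\<And>f. Q f = j (hilbert_adjoint j f)"
    and "closure (range (hilbert_adjoint j)) = UNIV"
    and "orthonormal_basis e"
    and "\<And>k. hilbert_adjoint j (vs k) = e k"
  shows "(\<forall>h. (\<integral>\<omega>. \<bar>Theta M X e vs h \<omega>\<bar>\<^sup>2 \<partial>M) = (norm h)\<^sup>2) \<and>
    (\<forall>C\<in>cylindrical_sets. cyl_distr M X C = theta_distr M X e vs (blinfun_apply j -` C)) \<and>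
    cyl_cotype 2 (theta_distr M X e vs) \<and>
    cyl_infinitely_divisible (theta_distr M X e vs)"
proof -
  interpret prob_space M by fact
  note e = \<open>orthonormal_basis e\<close>
  have X: "linear_process M X"
    using \<open>cylindrical_rv M X\<close> by (simp add: cylindrical_rv_def linear_process_def)
  note [measurable] = linear_process_measurable[OF X]
  have adj: "hilbert_adjoint j f \<bullet> x = f (j x)" for f x
    unfolding hilbert_adjoint_def by (simp add: riesz_inner[OF e])
  have second_moment: "(\<integral>\<omega>. (X f \<omega>)\<^sup>2 \<partial>M) = (norm (hilbert_adjoint j f))\<^sup>2" for f
  proof -
    have "(\<integral>\<omega>. (X f \<omega>)\<^sup>2 \<partial>M) = f (Q f)"
      using \<open>covariance_operator M X Q\<close> by (simp add: covariance_operator_def power2_eq_square)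
    also have "\<dots> = (norm (hilbert_adjoint j f))\<^sup>2"
      using adj[of f "hilbert_adjoint j f"] by (simp add: assms(7) power2_norm_eq_inner)
    finally show ?thesis .
  qed
  have adj_sum: "hilbert_adjoint j (\<Sum>k<n. c k *\<^sub>R vs k) = (\<Sum>k<n. c k *\<^sub>R e k)" for c and n :: nat
    by (subst vector_eq_rdot[symmetric])
      (simp add: adj blinfun.sum_left blinfun.scaleR_left inner_sum_left flip: assms(10))
  have adj_diff: "hilbert_adjoint j (f - g) = hilbert_adjoint j f - hilbert_adjoint j g" for f g
    by (subst vector_eq_rdot[symmetric]) (simp add: adj blinfun.diff_left inner_diff_left)
  have isometry: "(\<integral>\<omega>. (\<Sum>k<n. c k * X (vs k) \<omega>)\<^sup>2 \<partial>M) = (\<Sum>k<n. (c k)\<^sup>2)" for c and n :: nat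
  proof -
    have "(\<integral>\<omega>. (\<Sum>k<n. c k * X (vs k) \<omega>)\<^sup>2 \<partial>M) = (\<integral>\<omega>. (X (\<Sum>k<n. c k *\<^sub>R vs k) \<omega>)\<^sup>2 \<partial>M)"
      by (intro integral_cong_AE) (use linear_process_sum[OF X, where n = n and c = c and g = vs] in \<open>auto elim!: eventually_mono\<close>)
    also have "\<dots> = (\<Sum>k<n. (c k)\<^sup>2)"
      unfolding second_moment adj_sum by (rule orthonormal_norm_sum[OF e]) simp
    finally show ?thesis .
  qed
  have bessel: "bessel_sequence M (\<lambda>k. X (vs k))"
    by (simp add: bessel_sequence_def assms(4) isometry)
  let ?T = "L2_series M (\<lambda>k. X (vs k)) e"
  let ?Z = "\<lambda>f. ?T (riesz f)"
  have theta: "theta_distr M X e vs = cyl_distr M ?Z"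
    by (simp add: theta_distr_def Theta_eq_L2_series)
  have T_sums: "L2_sums M (\<lambda>k \<omega>. (e k \<bullet> h) * X (vs k) \<omega>) (?T h)" for h
    by (rule L2_sums_L2_series[OF bessel e])
  have Z: "linear_process M ?Z" by (rule linear_process_L2_series[OF bessel e])

  have norm_T: "(\<integral>\<omega>. (?T h \<omega>)\<^sup>2 \<partial>M) = (norm h)\<^sup>2" for h
  proof (rule LIMSEQ_unique)
    show "(\<lambda>n. \<integral>\<omega>. (\<Sum>k<n. (e k \<bullet> h) * X (vs k) \<omega>)\<^sup>2 \<partial>M) \<longlonglongrightarrow> (\<integral>\<omega>. (?T h \<omega>)\<^sup>2 \<partial>M)"
      by (rule L2_sums_square_integral[OF T_sums])
    show "(\<lambda>n. \<integral>\<omega>. (\<Sum>k<n. (e k \<bullet> h) * X (vs k) \<omega>)\<^sup>2 \<partial>M) \<longlonglongrightarrow> (norm h)\<^sup>2"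
      unfolding isometry using orthonormal_basis_expansion(2)[OF e, of h] by (simp add: sums_def)
  qed
  then have a: "\<forall>h. (\<integral>\<omega>. \<bar>Theta M X e vs h \<omega>\<bar>\<^sup>2 \<partial>M) = (norm h)\<^sup>2"
    by (simp add: Theta_eq_L2_series)

  \<comment> \<open>The partial sums for \<open>j\<^sup>* f\<close> are the values of \<open>X\<close> at \<open>\<Sum>\<^sub>k \<langle>e\<^sub>k, j\<^sup>* f\<rangle> v\<^sub>k\<^sup>*\<close>, and
      their mean square distance to \<open>X f\<close> is the squared distance of the partial expansion from
      \<open>j\<^sup>* f\<close>.\<close>
  have T_adj: "AE \<omega> in M. ?T (hilbert_adjoint j f) \<omega> = X f \<omega>" for f
  proof (rule L2_sums_unique[OF T_sums])
    let ?h = "hilbert_adjoint j f"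
    let ?s = "\<lambda>n. \<Sum>k<n. (e k \<bullet> ?h) *\<^sub>R vs k"
    have "(\<integral>\<omega>. ((\<Sum>k<n. (e k \<bullet> ?h) * X (vs k) \<omega>) - X f \<omega>)\<^sup>2 \<partial>M) =
        (norm ((\<Sum>k<n. (e k \<bullet> ?h) *\<^sub>R e k) - ?h))\<^sup>2" for n
    proof -
      have "AE \<omega> in M. X (?s n - f) \<omega> = (\<Sum>k<n. (e k \<bullet> ?h) * X (vs k) \<omega>) - X f \<omega>"
        using linear_process_combination[OF X, of 1 "?s n" "-1" f] linear_process_sum[OF X, where n = n and c = "\<lambda>k. e k \<bullet> ?h" and g = vs]
        by eventually_elim simp
      then have "(\<integral>\<omega>. ((\<Sum>k<n. (e k \<bullet> ?h) * X (vs k) \<omega>) - X f \<omega>)\<^sup>2 \<partial>M) = (\<integral>\<omega>. (X (?s n - f) \<omega>)\<^sup>2 \<partial>M)"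
        by (intro integral_cong_AE) (auto elim!: eventually_mono)
      then show ?thesis by (simp add: second_moment adj_diff adj_sum)
    qed
    moreover have "(\<lambda>n. (norm ((\<Sum>k<n. (e k \<bullet> ?h) *\<^sub>R e k) - ?h))\<^sup>2) \<longlonglongrightarrow> 0"
      using orthonormal_basis_expansion(1)[OF e, of ?h]
      by (intro tendsto_eq_intros tendsto_norm_zero) (auto simp: sums_def LIM_zero_iff)
    ultimately show "L2_sums M (\<lambda>k \<omega>. (e k \<bullet> ?h) * X (vs k) \<omega>) (X f)"
      using assms(4) by (simp add: L2_sums_def square_integrable_scale)
  qed
  have b: "\<forall>C\<in>cylindrical_sets. cyl_distr M X C = theta_distr M X e vs (blinfun_apply j -` C)"
  proof
    fix C :: "'v set" assume "C \<in> cylindrical_sets"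
    then obtain n f B where B [measurable]: "B \<in> sets (\<Pi>\<^sub>M i\<in>{..<n}. (borel :: real measure))"
      and C: "C = cyl_set n f B" by (auto simp: cylindrical_sets_def)
    note [measurable] = linear_process_measurable[OF Z]
    have pre: "blinfun_apply j -` C = cyl_set n (\<lambda>i. f i o\<^sub>L j) B"
      by (simp add: C cyl_set_def vimage_def)
    have "AE \<omega> in M. \<forall>i\<in>{..<n}. ?Z (f i o\<^sub>L j) \<omega> = X (f i) \<omega>"
      using T_adj by (simp add: AE_ball_countable hilbert_adjoint_def)
    then have "emeasure M {\<omega> \<in> space M. (\<lambda>i\<in>{..<n}. X (f i) \<omega>) \<in> B} =
        emeasure M {\<omega> \<in> space M. (\<lambda>i\<in>{..<n}. ?Z (f i o\<^sub>L j) \<omega>) \<in> B}"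
      by (intro emeasure_eq_AE) (auto elim!: eventually_mono cong: restrict_cong)
    then show "cyl_distr M X C = theta_distr M X e vs (blinfun_apply j -` C)"
      unfolding theta pre cyl_distr_cyl_set[OF Z B] by (simp add: C cyl_distr_cyl_set[OF X B])
  qed

  have moment: "cyl_moment (cyl_distr M ?Z) 2 f = ennreal ((norm f)\<^sup>2)" for f
  proof -
    have "cyl_moment (cyl_distr M ?Z) 2 f = (\<integral>\<^sup>+\<omega>. ennreal ((?Z f \<omega>)\<^sup>2) \<partial>M)"
      unfolding cyl_moment_cyl_distr[OF Z] by (intro nn_integral_cong) simp
    also have "\<dots> = ennreal ((norm f)\<^sup>2)"
      using square_integrable_L2_series[OF bessel e, of "riesz f"]
      by (subst nn_integral_eq_integral) (auto simp: square_integrable_def norm_T norm_riesz[OF e])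
    finally show ?thesis .
  qed
  have c: "cyl_cotype 2 (theta_distr M X e vs)"
    unfolding cyl_cotype_def theta
  proof (intro conjI allI impI)
    show "cylindrical_prob (cyl_distr M ?Z)" by (rule cylindrical_prob_L2_series[OF bessel e])
    show "cyl_moment (cyl_distr M ?Z) 2 f < \<infinity>" for f by (simp add: moment)
    fix f :: "nat \<Rightarrow> 'h \<Rightarrow>\<^sub>L real"
    assume "(\<lambda>n. cyl_moment (cyl_distr M ?Z) 2 (f n)) \<longlonglongrightarrow> 0"
    then have "(\<lambda>n. (norm (f n))\<^sup>2) \<longlonglongrightarrow> 0"
      unfolding moment by (subst (asm) ennreal_0[symmetric], subst (asm) tendsto_ennreal_iff) auto
    then have "(\<lambda>n. sqrt ((norm (f n))\<^sup>2)) \<longlonglongrightarrow> sqrt 0" by (rule tendsto_real_sqrt)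
    then show "(\<lambda>n. norm (f n)) \<longlonglongrightarrow> 0" by simp
  qed

  have d: "cyl_infinitely_divisible (theta_distr M X e vs)"
    unfolding theta
    by (rule cyl_infinitely_divisible_L2_series[OF assms(1) X assms(3) bessel assms(5) e])
  from a b c d show ?thesis by blast
qed

end
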